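(* Assume that the polynomial degree satisfies $p\ge1$, that the time step satisfies $h\lesssim\Delta t$ (i.e. $h\le C_{\mathrm s}\,\Delta t$ for a constant $C_{\mathrm s}>0$), and that the material coefficients $C_{\mathrm n},C_{\mathrm m},C_{\mathrm u},C_{\mathrm r}$ are edgewise constant. Then there exist constants $0<\alpha\le\beta<\infty$, depending only on the material parameters, the diameter of the domain $\Omega$, the final time $T$, and the constant $C_{\mathrm s}$, such that for all $\lambda\in\Lambda$ $$\alpha\Big(\frac{\mathcal M_{\mathcal G}(\lambda,\lambda)}{(\Delta t)^2}+\mathcal L_{\mathcal G}(\lambda,\lambda)\Big)\le\hat A(\lambda,\lambda)\le\beta\Big(\frac{\mathcal M_{\mathcal G}(\lambda,\lambda)}{(\Delta t)^2}+\mathcal L_{\mathcal G}(\lambda,\lambda)\Big).$$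
   Context: Network. $\Omega\subset\mathbb R^3$ is a bounded domain and $\mathcal G=(\mathcal N,\mathcal E)$ is a finite connected graph embedded in $\Omega$ with at least one edge; $\mathcal N$ is the set of nodes (points) and each edge $e\in\mathcal E$ is an open straight segment of length $h_e>0$ joining two nodes. $h=\max_{e\in\mathcal E}h_e$, $\Sigma=\bigcup_{e}\bar e$. $\mathcal I$ is the set of pairs $(e,n)\in\mathcal E\times\mathcal N$ such that $n$ is an endpoint of $e$. Each edge has a fixed unit tangent vector $i_e\in\mathbb R^3$ (an edgewise constant function $i$ on $\Sigma$); $\nu_e(n)=+1$ if $i_e$ points towards $n$ and $\nu_e(n)=-1$ otherwise, for $(e,n)\in\mathcal I$. $\partial_x$ is the derivative along each edge with respect to arclength in direction $i_e$. $\mathcal N_D\subset\mathcal N$ is a non-empty set of Dirichlet nodes, and $\Lambda=\{\lambda:\mathcal N\to\mathbb R^6\mid\lambda=0\text{ on }\mathcal N_D\}$. Coefficients. $C_{\mathrm n},C_{\mathrm m},C_{\mathrm u},C_{\mathrm r}:\Sigma\to\mathbb R^{3\times3}_{\mathrm{sym}}$ satisfy $c_{\bullet,\min}|\xi|^2\le\xi^\top C_\bullet(x)\xi\le c_{\bullet,\max}|\xi|^2$ for all $\xi\in\mathbb R^3$, a.e. $x\in\Sigma$, with constants $0<c_{\bullet,\min}\le c_{\bullet,\max}<\infty$, for $\bullet\in\{\mathrm n,\mathrm m,\mathrm u,\mathrm r\}$; dependence on the material parameters means dependence on these bounds. $C_{\mathrm q}=\operatorname{diag}(C_{\mathrm n},C_{\mathrm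 m})$, $C_{\mathrm y}=\operatorname{diag}(C_{\mathrm u},C_{\mathrm r})$ ($6\times6$ block matrices). Discrete setting. $T>0$ and $\Delta t\in(0,T]$ is the step size of a uniform partition of $[0,T]$. $V^p$ is the space of functions $\Sigma\to\mathbb R^6$ whose components on each edge are polynomials of degree at most $p$ in arclength. $\tau$ is a strictly positive edgewise constant function. $(\cdot,\cdot)_\Sigma$ is the $L^2(\Sigma;\mathbb R^6)$ inner product (sum of edge integrals with one-dimensional measure). For $\psi,\phi$ with nodal traces $\psi_e(n),\phi_e(n)$ from each edge, $\langle\psi,\phi\rangle_{\mathcal E}=\sum_{e\in\mathcal E}\sum_{n:(e,n)\in\mathcal I}\psi_e(n)\cdot\phi_e(n)$; nodal functions are used with the same value from every incident edge; $\psi\nu$ has traces $\psi_e(n)\nu_e(n)$. For $q=(n,m)$ (pairs of $\mathbb R^3$-valued functions) set $i_\times q=(0,i\times n)$; $a(q,w)=(C_{\mathrm q}^{-1}q,w)_\Sigma$, $b(q,y)=-(\partial_xq+i_\times q,y)_\Sigma$, $d(z,w)=(C_{\mathrm y}^{-1}z,w)_\Sigma$. Local solvers. For $\lambda\in\Lambda$, $(Q(\lambda),Y(\lambda),Z(\lambda))\in V^p\times V^p\times V^p$ denotes the unique solution of $a(Q(\lambda),w)+b(w,Y(\lambda))=-\langle\lambda,w\nu\rangle_{\mathcal E}$, $-b(Q(\lambda),w)+\langle\tau(Y(\lambda)-\lambda),w\rangle_{\mathcal E}+\frac{2}{\Delta t}(Z(\lambda),w)_\Sigma=0$, $-\frac{2}{\Delta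 t}(Y(\lambda),w)_\Sigma+d(Z(\lambda),w)=0$, each for all $w\in V^p$ (these problems decouple over the edges). Condensed bilinear form. For $\lambda,\mu\in\Lambda$, $\hat A(\lambda,\mu)=-\langle Q(\lambda)\nu+\tau(Y(\lambda)-\lambda),\mu\rangle_{\mathcal E}$. Graph operators. For $\lambda,\mu\in\Lambda$, summing over edges $e$ with endpoints $n_i,n_j$: $\mathcal M_{\mathcal G}(\lambda,\mu)=\sum_{e\in\mathcal E}\frac12h_e\big(\lambda(n_i)\cdot\mu(n_i)+\lambda(n_j)\cdot\mu(n_j)\big)$, and $\mathcal L_{\mathcal G}(\lambda,\mu)=\sum_{e\in\mathcal E}\frac12h_e^{-1}\big(\lambda(n_i)-\lambda(n_j)\big)\cdot\big(\mu(n_i)-\mu(n_j)\big)$. *)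

theory Defs
  imports
    "HOL-Analysis.Analysis"
    "HOL-Computational_Algebra.Polynomial"
begin

unbundle no cross3_syntax

type_synonym point = "real^3"

text \<open>An edge is the ordered pair of its endpoints; the order records the direction of the
  fixed unit tangent, which points from \<open>fst e\<close> to \<open>snd e\<close>.\<close>

type_synonym edge = "point \<times> point"

text \<open>\<open>\<real>\<^sup>6\<close> is represented as \<open>\<real>\<^sup>3 \<times> \<real>\<^sup>3\<close>, i.e. by the pairs \<open>(n, m)\<close>; the inner product of
  the product type is the Euclidean one.\<close>

type_synonym vec6 = "(real^3) \<times> (real^3)"

text \<open>A field on the network, possibly discontinuous at the nodes, is given on each edge \<open>e\<close> as a
  function of the arclength \<open>s \<in> {0..len e}\<close> measured from \<open>fst e\<close>.\<close>

type_synonym field6 = "edge \<Rightarrow> real \<Rightarrow> vec6"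

record network =
  nodes :: "point set"
  edges :: "edge set"
  dirichlet :: "point set"

record material =
  C_n :: "point \<Rightarrow> real^3^3"
  C_m :: "point \<Rightarrow> real^3^3"
  C_u :: "point \<Rightarrow> real^3^3"
  C_r :: "point \<Rightarrow> real^3^3"


subsection \<open>Geometry\<close>

definition len :: "edge \<Rightarrow> real" where
  "len e = dist (fst e) (snd e)"

definition tangent :: "edge \<Rightarrow> real^3" where
  "tangent e = (snd e - fst e) /\<^sub>R len e"

definition edge_point :: "edge \<Rightarrow> real \<Rightarrow> point" where
  "edge_point e s = fst e + s *\<^sub>R tangent e"

definition skeleton :: "network \<Rightarrow> point set" where
  "skeleton G = (\<Union>e\<in>edges G. closed_segment (fst e) (snd e))"

definition mesh_size :: "network \<Rightarrow> real" where
  "mesh_size G = Max (len ` edges G)"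

definition incidence :: "network \<Rightarrow> (edge \<times> point) set" where
  "incidence G = {(e, n). e \<in> edges G \<and> n \<in> nodes G \<and> (n = fst e \<or> n = snd e)}"

definition nu :: "edge \<Rightarrow> point \<Rightarrow> real" where
  "nu e n = (if n = snd e then 1 else -1)"

definition graph_connected :: "network \<Rightarrow> bool" where
  "graph_connected G \<longleftrightarrow> (\<forall>a\<in>nodes G. \<forall>b\<in>nodes G. (a, b) \<in> (edges G \<union> (edges G)\<inverse>)\<^sup>*)"

text \<open>A bounded domain together with a finite connected graph embedded in it by open straight
  segments. Disjointness of distinct open edges in particular rules out that \<open>(a, b)\<close> and \<open>(b, a)\<close>
  are both listed, so every edge carries exactly one orientation.\<close>

definition network_in :: "point set \<Rightarrow> network \<Rightarrow> bool" where
  "network_in \<Omega> G \<longleftrightarrow>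
     open \<Omega> \<and> connected \<Omega> \<and> bounded \<Omega> \<and>
     finite (nodes G) \<and> edges G \<noteq> {} \<and>
     (\<forall>e\<in>edges G. fst e \<in> nodes G \<and> snd e \<in> nodes G \<and> fst e \<noteq> snd e) \<and>
     graph_connected G \<and>
     nodes G \<subseteq> \<Omega> \<and> skeleton G \<subseteq> \<Omega> \<and>
     (\<forall>e\<in>edges G. open_segment (fst e) (snd e) \<inter> nodes G = {}) \<and>
     (\<forall>e\<in>edges G. \<forall>e'\<in>edges G. e \<noteq> e' \<longrightarrow>
        open_segment (fst e) (snd e) \<inter> open_segment (fst e') (snd e') = {}) \<and>
     dirichlet G \<noteq> {} \<and> dirichlet G \<subseteq> nodes G"


subsection \<open>Coefficients\<close>

definition elliptic_coeff :: "network \<Rightarrow> real \<Rightarrow> real \<Rightarrow> (point \<Rightarrow> real^3^3) \<Rightarrow> bool" where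
  "elliptic_coeff G cmin cmax C \<longleftrightarrow>
     (\<forall>x\<in>skeleton G. transpose (C x) = C x) \<and>
     (\<forall>e\<in>edges G. AE s in lborel. s \<in> {0..len e} \<longrightarrow>
        (\<forall>\<xi>. cmin * (norm \<xi>)\<^sup>2 \<le> \<xi> \<bullet> (C (edge_point e s) *v \<xi>) \<and>
             \<xi> \<bullet> (C (edge_point e s) *v \<xi>) \<le> cmax * (norm \<xi>)\<^sup>2))"

definition edgewise_constant :: "network \<Rightarrow> (point \<Rightarrow> 'a) \<Rightarrow> bool" where
  "edgewise_constant G C \<longleftrightarrow>
     (\<forall>e\<in>edges G. \<exists>c. \<forall>x\<in>open_segment (fst e) (snd e). C x = c)"

definition block_diag :: "real^3^3 \<Rightarrow> real^3^3 \<Rightarrow> vec6 \<Rightarrow> vec6" where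
  "block_diag A B q = (A *v fst q, B *v snd q)"

definition Cq :: "material \<Rightarrow> point \<Rightarrow> vec6 \<Rightarrow> vec6" where
  "Cq C x = block_diag (C_n C x) (C_m C x)"

definition Cy :: "material \<Rightarrow> point \<Rightarrow> vec6 \<Rightarrow> vec6" where
  "Cy C x = block_diag (C_u C x) (C_r C x)"


subsection \<open>Discrete spaces\<close>

text \<open>Components are polynomials in arclength on each edge. Values outside the edges carry no
  information and are normalised to \<open>0\<close>, so that equality of fields is equality on the network.
  The same convention is used for nodal functions.\<close>

definition V :: "network \<Rightarrow> nat \<Rightarrow> field6 set" where
  "V G p = {\<psi>.
     (\<forall>e\<in>edges G. \<forall>b\<in>Basis. \<exists>P::real poly. degree P \<le> p \<and>
        (\<forall>s\<in>{0..len e}. \<psi> e s \<bullet> b = poly P s)) \<and>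
     (\<forall>e s. e \<notin> edges G \<or> s \<notin> {0..len e} \<longrightarrow> \<psi> e s = 0)}"

definition nodal_space :: "network \<Rightarrow> (point \<Rightarrow> vec6) set" where
  "nodal_space G = {lam. (\<forall>n\<in>dirichlet G. lam n = 0) \<and> (\<forall>n. n \<notin> nodes G \<longrightarrow> lam n = 0)}"


subsection \<open>Bilinear forms\<close>

text \<open>Gauge integrals; on the products of edgewise constant coefficients and polynomials used below
  they agree with Lebesgue integrals in arclength.\<close>

definition L2_inner :: "network \<Rightarrow> field6 \<Rightarrow> field6 \<Rightarrow> real" where
  "L2_inner G \<psi> \<phi> = (\<Sum>e\<in>edges G. integral {0..len e} (\<lambda>s. \<psi> e s \<bullet> \<phi> e s))"

definition trace_at :: "field6 \<Rightarrow> edge \<Rightarrow> point \<Rightarrow> vec6" where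
  "trace_at \<psi> e n = \<psi> e (if n = snd e then len e else 0)"

text \<open>The arguments are the nodal traces \<open>\<psi>\<^sub>e(n)\<close>, \<open>\<phi>\<^sub>e(n)\<close>.\<close>

definition edge_inner ::
    "network \<Rightarrow> (edge \<Rightarrow> point \<Rightarrow> vec6) \<Rightarrow> (edge \<Rightarrow> point \<Rightarrow> vec6) \<Rightarrow> real" where
  "edge_inner G \<psi> \<phi> = (\<Sum>e\<in>edges G. \<Sum>n | (e, n) \<in> incidence G. \<psi> e n \<bullet> \<phi> e n)"

definition dx :: "field6 \<Rightarrow> field6" where
  "dx \<psi> e s = vector_derivative (\<psi> e) (at s within {0..len e})"

definition i_cross :: "field6 \<Rightarrow> field6" where
  "i_cross q e s = (0, cross3 (tangent e) (fst (q e s)))"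

definition form_a :: "network \<Rightarrow> material \<Rightarrow> field6 \<Rightarrow> field6 \<Rightarrow> real" where
  "form_a G C q w = L2_inner G (\<lambda>e s. inv (Cq C (edge_point e s)) (q e s)) w"

definition form_b :: "network \<Rightarrow> field6 \<Rightarrow> field6 \<Rightarrow> real" where
  "form_b G q y = - L2_inner G (\<lambda>e s. dx q e s + i_cross q e s) y"

definition form_d :: "network \<Rightarrow> material \<Rightarrow> field6 \<Rightarrow> field6 \<Rightarrow> real" where
  "form_d G C z w = L2_inner G (\<lambda>e s. inv (Cy C (edge_point e s)) (z e s)) w"


subsection \<open>Local solvers and condensed form\<close>

definition local_solution ::
    "network \<Rightarrow> material \<Rightarrow> nat \<Rightarrow> (edge \<Rightarrow> real) \<Rightarrow> real \<Rightarrow> (point \<Rightarrow> vec6) \<Rightarrow>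
     field6 \<times> field6 \<times> field6 \<Rightarrow> bool" where
  "local_solution G C p \<tau> \<Delta>t lam = (\<lambda>(Q, Y, Z).
     Q \<in> V G p \<and> Y \<in> V G p \<and> Z \<in> V G p \<and>
     (\<forall>w\<in>V G p.
        form_a G C Q w + form_b G w Y
          = - edge_inner G (\<lambda>e. lam) (\<lambda>e n. nu e n *\<^sub>R trace_at w e n)) \<and>
     (\<forall>w\<in>V G p.
        - form_b G Q w
          + edge_inner G (\<lambda>e n. \<tau> e *\<^sub>R (trace_at Y e n - lam n)) (trace_at w)
          + 2 / \<Delta>t * L2_inner G Z w = 0) \<and>
     (\<forall>w\<in>V G p. - (2 / \<Delta>t) * L2_inner G Y w + form_d G C Z w = 0))"

definition local_solver ::
    "network \<Rightarrow> material \<Rightarrow> nat \<Rightarrow> (edge \<Rightarrow> real) \<Rightarrow> real \<Rightarrow> (point \<Rightarrow> vec6) \<Rightarrow>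
     field6 \<times> field6 \<times> field6" where
  "local_solver G C p \<tau> \<Delta>t lam = (THE QYZ. local_solution G C p \<tau> \<Delta>t lam QYZ)"

definition A_hat ::
    "network \<Rightarrow> material \<Rightarrow> nat \<Rightarrow> (edge \<Rightarrow> real) \<Rightarrow> real \<Rightarrow>
     (point \<Rightarrow> vec6) \<Rightarrow> (point \<Rightarrow> vec6) \<Rightarrow> real" where
  "A_hat G C p \<tau> \<Delta>t lam \<mu> =
     (case local_solver G C p \<tau> \<Delta>t lam of (Q, Y, Z) \<Rightarrow>
        - edge_inner G
            (\<lambda>e n. nu e n *\<^sub>R trace_at Q e n + \<tau> e *\<^sub>R (trace_at Y e n - lam n)) (\<lambda>e. \<mu>))"


subsection \<open>Graph operators\<close>

definition M_graph :: "network \<Rightarrow> (point \<Rightarrow> vec6) \<Rightarrow> (point \<Rightarrow> vec6) \<Rightarrow> real" where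
  "M_graph G lam \<mu> =
     (\<Sum>e\<in>edges G. 1/2 * len e * (lam (fst e) \<bullet> \<mu> (fst e) + lam (snd e) \<bullet> \<mu> (snd e)))"

definition L_graph :: "network \<Rightarrow> (point \<Rightarrow> vec6) \<Rightarrow> (point \<Rightarrow> vec6) \<Rightarrow> real" where
  "L_graph G lam \<mu> =
     (\<Sum>e\<in>edges G. 1/2 * inverse (len e) *
        ((lam (fst e) - lam (snd e)) \<bullet> (\<mu> (fst e) - \<mu> (snd e))))"

end

theory Submission
  imports Defs "HOL-Library.Function_Algebras"
begin

text \<open>
  For edgewise constant coefficients the third equation gives \<open>Z = (2/\<Delta>t) C\<^sub>y Y\<close>. Testing the other two
  with \<open>Q\<close> and \<open>Y\<close> turns \<open>A_hat(\<lambda>, \<lambda>)\<close> into the energy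
  \<open>a(Q, Q) + \<langle>\<tau>(Y - \<lambda>), Y - \<lambda>\<rangle> + (4/\<Delta>t\<^sup>2) (C\<^sub>y Y, Y)\<close>, whose definiteness also yields unique
  solvability.

  Lower bound: the first equation is tested with edgewise affine functions \<open>w\<close>. The constants
  \<open>w = (\<lambda>(n\<^sub>j) - \<lambda>(n\<^sub>i)) / h\<^sub>e\<close> produce \<open>2 L_graph\<close>, and the functions with traces
  \<open>w \<nu> = h\<^sub>e \<lambda>\<close> produce \<open>2 M_graph\<close> on the right-hand side; Young's inequality bounds both by
  \<open>C\<^sub>q\<^sup>-\<^sup>1 Q\<close> and \<open>Y\<close> in \<open>L\<^sup>2\<close>. The penalty term is only used to be nonnegative, so \<open>\<tau>\<close> does not
  enter the constants.

  Upper bound: the second equation is tested with the edgewise affine interpolant of \<open>\<lambda>\<close>. After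
  integration by parts the boundary terms cancel, and Young's inequality absorbs half of the energy.
\<close>

subsection \<open>Edgewise polynomial fields\<close>

text \<open>A finite-dimensional Lax-Milgram argument for a form that need not be symmetric, proved
  by induction over a spanning set. Linearity is demanded only on the span, because the integrals in
  the later application are additive only for sufficiently regular fields.\<close>

lemma (in vector_space) span_definite_form_representer:
  assumes "finite S"
    and "\<And>r u v w. \<lbrakk>u \<in> span S; v \<in> span S; w \<in> span S\<rbrakk> \<Longrightarrow> B (scale r u + v) w = r * B u w + B v w"
    and "\<And>r u v w. \<lbrakk>u \<in> span S; v \<in> span S; w \<in> span S\<rbrakk> \<Longrightarrow> B w (scale r u + v) = r * B w u + B w v"
    and "\<And>u. \<lbrakk>u \<in> span S; u \<noteq> 0\<rbrakk> \<Longrightarrow> B u u \<noteq> 0"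
    and "\<And>r u v. \<lbrakk>u \<in> span S; v \<in> span S\<rbrakk> \<Longrightarrow> F (scale r u + v) = r * F u + F v"
  shows "\<exists>u\<in>span S. \<forall>w\<in>span S. B u w = F w"
  using assms
proof (induction S arbitrary: F rule: finite_induct)
  case empty
  \<comment> \<open>Linearity is assumed in combined form only; its instance at zero with
    \<open>r = 1\<close> yields \<open>F 0 = 0\<close> and \<open>B 0 0 = 0\<close>.\<close>
  have "F (scale 1 0 + 0) = 1 * F 0 + F 0" "B 0 (scale 1 0 + 0) = 1 * B 0 0 + B 0 0"
    by (rule empty; simp)+
  then have "F 0 = F 0 + F 0" "B 0 0 = B 0 0 + B 0 0" by simp_all
  then show ?case by (metis add_cancel_right_right empty_iff insert_iff span_empty span_zero)
next
  case (insert x S)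
  let ?W = "span (insert x S)"
  have sub: "v \<in> span S \<Longrightarrow> v \<in> ?W" for v
    using span_mono[of S "insert x S"] by blast
  have xW: "x \<in> ?W" by (simp add: span_base)
  have zero: "0 \<in> ?W" by (rule span_zero)
  have solvable: "\<exists>u\<in>span S. \<forall>w\<in>span S. B u w = f w"
    if "\<And>r u v. \<lbrakk>u \<in> span S; v \<in> span S\<rbrakk> \<Longrightarrow> f (scale r u + v) = r * f u + f v" for f
    using insert.prems(1-3) sub that by (intro insert.IH) auto
  obtain u0 where u0: "u0 \<in> span S" "\<And>w. w \<in> span S \<Longrightarrow> B u0 w = F w"
    using solvable[of F] insert.prems(4) sub by blast
  obtain v where v: "v \<in> span S" "\<And>w. w \<in> span S \<Longrightarrow> B v w = B x w"
    using solvable[of "B x"] insert.prems(2) sub xW by blast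
  \<comment> \<open>Gram-Schmidt step; left orthogonality suffices as \<open>B\<close> need not be symmetric\<close>
  define y where "y = x - v"
  have yW: "y \<in> ?W" unfolding y_def using xW v(1) sub by (intro span_diff) auto
  have y_orth: "B y w = 0" if "w \<in> span S" for w
    using insert.prems(1)[of v x w "-1"] v that sub xW by (simp add: y_def)
  have decomp: "\<exists>k z. z \<in> span S \<and> w = scale k y + z" if "w \<in> ?W" for w
  proof -
    obtain k where k: "w - scale k x \<in> span S"
      using \<open>w \<in> ?W\<close> span_breakdown_eq by blast
    have "w = scale k y + (w - scale k x + scale k v)"
      by (simp add: y_def scale_right_diff_distrib)
    then show ?thesis using k v(1) by (metis span_add span_scale)
  qed
  show ?case
  proof (cases "y = 0")
    case True
    then have "?W = span S" using v(1) by (simp add: y_def span_redundant)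
    then show ?thesis using u0 by auto
  next
    case False
    \<comment> \<open>Since \<open>y\<close> is left orthogonal to \<open>span S\<close>, adding a
      multiple of it to \<open>u0\<close> preserves the equations on \<open>span S\<close>. This
      multiple removes the residual of \<open>u0\<close> at \<open>y\<close> itself.\<close>
    define t where "t = (F y - B u0 y) / B y y"
    have Byy: "B y y \<noteq> 0" using insert.prems(3) yW False by blast
    have uW: "scale t y + u0 \<in> ?W" using yW u0(1) sub by (simp add: span_add span_scale)
    moreover have "B (scale t y + u0) w = F w" if "w \<in> ?W" for w
    proof -
      obtain k z where z: "z \<in> span S" and w: "w = scale k y + z" using decomp \<open>w \<in> ?W\<close> by blast
      have "B (scale t y + u0) y = F y"
        using insert.prems(1)[of y u0 y t] yW u0(1) sub Byy by (simp add: t_def)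
      moreover have "B (scale t y + u0) z = F z"
        using insert.prems(1)[of y u0 z t] yW u0 sub z y_orth by simp
      ultimately show ?thesis
        using insert.prems(2)[of y z "scale t y + u0" k] insert.prems(4)[of y z k] yW uW z sub w
        by simp
    qed
    ultimately show ?thesis by blast
  qed
qed

text \<open>The target space is generic so that the pairs \<open>(Q, Y)\<close> also form such a space.\<close>

definition edgewise_poly :: "'e set \<Rightarrow> ('e \<Rightarrow> real) \<Rightarrow> nat \<Rightarrow> ('e \<Rightarrow> real \<Rightarrow> 'v::euclidean_space) set" where
  "edgewise_poly E h p = {\<psi>.
     (\<forall>e\<in>E. \<forall>b\<in>Basis. \<exists>P::real poly. degree P \<le> p \<and> (\<forall>s\<in>{0..h e}. \<psi> e s \<bullet> b = poly P s)) \<and>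
     (\<forall>e s. e \<notin> E \<or> s \<notin> {0..h e} \<longrightarrow> \<psi> e s = 0)}"

lemma V_eq_edgewise_poly: "V G p = edgewise_poly (edges G) len p"
  by (simp add: V_def edgewise_poly_def)

text \<open>Scalar multiplication to go with the pointwise addition of functions, so that the locale
  \<open>vector_space\<close> and its span apply to fields.\<close>

definition field_scale :: "real \<Rightarrow> ('e \<Rightarrow> real \<Rightarrow> 'v::real_vector) \<Rightarrow> ('e \<Rightarrow> real \<Rightarrow> 'v)" where
  "field_scale r \<psi> = (\<lambda>e s. r *\<^sub>R \<psi> e s)"

interpretation fields: vector_space "field_scale :: real \<Rightarrow> ('e \<Rightarrow> real \<Rightarrow> 'v::real_vector) \<Rightarrow> _"
  by unfold_locales (auto simp: field_scale_def fun_eq_iff algebra_simps)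

lemma edgewise_poly_linear_comb:
  assumes "\<psi> \<in> edgewise_poly E h p" "\<phi> \<in> edgewise_poly E h p"
  shows "(\<lambda>e s. r *\<^sub>R \<psi> e s + \<phi> e s) \<in> edgewise_poly E h p"
proof -
  have "\<exists>R::real poly. degree R \<le> p \<and> (\<forall>s\<in>{0..h e}. (r *\<^sub>R \<psi> e s + \<phi> e s) \<bullet> b = poly R s)"
    if e: "e \<in> E" and b: "b \<in> Basis" for e b
  proof -
    obtain P Q :: "real poly" where "degree P \<le> p" "\<forall>s\<in>{0..h e}. \<psi> e s \<bullet> b = poly P s"
      "degree Q \<le> p" "\<forall>s\<in>{0..h e}. \<phi> e s \<bullet> b = poly Q s"
      using assms e b unfolding edgewise_poly_def by blast
    then show ?thesis
      by (intro exI[of _ "smult r P + Q"]) (auto simp: inner_add_left intro!: degree_add_le)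
  qed
  then show ?thesis using assms unfolding edgewise_poly_def by auto
qed

lemma subspace_edgewise_poly: "fields.subspace (edgewise_poly E h p)"
proof (rule fields.subspaceI)
  show zero: "0 \<in> edgewise_poly E h p"
    unfolding edgewise_poly_def by (auto intro!: exI[of _ 0])
  show "x + y \<in> edgewise_poly E h p" if "x \<in> edgewise_poly E h p" "y \<in> edgewise_poly E h p" for x y
    using edgewise_poly_linear_comb[OF that, of 1] by (simp add: plus_fun_def)
  show "field_scale c x \<in> edgewise_poly E h p" if "x \<in> edgewise_poly E h p" for c x
    using edgewise_poly_linear_comb[OF that zero, of c] by (simp add: field_scale_def zero_fun_def)
qed

lemma sum_fun_apply2: "(\<Sum>i\<in>I. f i) x y = (\<Sum>i\<in>I. f i x y)"
  by (induction I rule: infinite_finite_induct) auto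

text \<open>The monomials \<open>s ^ k *\<^sub>R b\<close> supported on a single edge span the
  space; coordinate coefficients are read off the polynomials. This makes the representer lemma
  applicable to the discrete problem.\<close>

lemma edgewise_poly_finite_span:
  assumes "finite E"
  shows "\<exists>S. finite S \<and> edgewise_poly E h p = fields.span (S :: ('e \<Rightarrow> real \<Rightarrow> 'v::euclidean_space) set)"
proof -
  define m :: "'e \<times> 'v \<times> nat \<Rightarrow> 'e \<Rightarrow> real \<Rightarrow> 'v" where
    "m = (\<lambda>(e, b, k) e' s. if e' = e \<and> s \<in> {0..h e} then s ^ k *\<^sub>R b else 0)"
  define I :: "('e \<times> 'v \<times> nat) set" where "I = E \<times> Basis \<times> {..p}"
  have "finite I" using assms by (simp add: I_def)
  have m_in: "m i \<in> edgewise_poly E h p" if "i \<in> I" for i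
  proof -
    obtain e b k where i: "i = (e, b, k)" "e \<in> E" "b \<in> Basis" "k \<le> p"
      using \<open>i \<in> I\<close> unfolding I_def by blast
    have "\<exists>P::real poly. degree P \<le> p \<and> (\<forall>s\<in>{0..h e'}. m i e' s \<bullet> b' = poly P s)"
      if "b' \<in> Basis" for e' b'
      using i that
      by (intro exI[of _ "if e' = e \<and> b' = b then monom 1 k else 0"])
         (auto simp: m_def inner_Basis poly_monom degree_monom_eq)
    then show ?thesis using i unfolding edgewise_poly_def by (auto simp: m_def)
  qed
  have "\<psi> \<in> fields.span (m ` I)" if \<psi>: "\<psi> \<in> edgewise_poly E h p" for \<psi>
  proof -
    have "\<forall>e b. \<exists>P::real poly. e \<in> E \<and> b \<in> Basis \<longrightarrow> degree P \<le> p \<and> (\<forall>s\<in>{0..h e}. \<psi> e s \<bullet> b = poly P s)"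
      using \<psi> unfolding edgewise_poly_def by blast
    then obtain P :: "'e \<Rightarrow> 'v \<Rightarrow> real poly" where P: "\<And>e b. e \<in> E \<Longrightarrow> b \<in> Basis \<Longrightarrow> degree (P e b) \<le> p"
      "\<And>e b s. e \<in> E \<Longrightarrow> b \<in> Basis \<Longrightarrow> s \<in> {0..h e} \<Longrightarrow> \<psi> e s \<bullet> b = poly (P e b) s"
      by metis
    define c where "c = (\<lambda>(e, b, k). coeff (P e b) k)"
    have "(\<Sum>i\<in>I. c i *\<^sub>R m i e s) = \<psi> e s" for e s
    proof (cases "e \<in> E \<and> s \<in> {0..h e}")
      case True
      have "(\<Sum>i\<in>I. c i *\<^sub>R m i e s)
          = (\<Sum>e'\<in>E. \<Sum>b\<in>Basis. \<Sum>k\<le>p. if e' = e then (coeff (P e b) k * s ^ k) *\<^sub>R b else 0)"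
        using True unfolding I_def sum.cartesian_product c_def m_def
        by (intro sum.cong) (auto split: if_splits)
      also have "\<dots> = (\<Sum>e'\<in>E. if e' = e then (\<Sum>b\<in>Basis. \<Sum>k\<le>p. (coeff (P e b) k * s ^ k) *\<^sub>R b) else 0)"
        by (intro sum.cong) auto
      also have "\<dots> = (\<Sum>b\<in>Basis. (\<Sum>k\<le>p. coeff (P e b) k * s ^ k) *\<^sub>R b)"
        using True assms by (simp add: scaleR_left.sum)
      also have "\<dots> = (\<Sum>b\<in>Basis. (\<psi> e s \<bullet> b) *\<^sub>R b)"
      proof (intro sum.cong refl)
        fix b :: 'v assume b: "b \<in> Basis"
        \<comment> \<open>The sum up to the actual degree may be extended to \<open>p\<close>, as
          the further coefficients vanish.\<close>
        have "poly (P e b) s = (\<Sum>k\<le>p. coeff (P e b) k * s ^ k)"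
          unfolding poly_altdef using P(1)[of e b] b True
          by (intro sum.mono_neutral_left) (auto simp: coeff_eq_0)
        then show "(\<Sum>k\<le>p. coeff (P e b) k * s ^ k) *\<^sub>R b = (\<psi> e s \<bullet> b) *\<^sub>R b"
          using P(2)[of e b s] b True by simp
      qed
      finally show ?thesis by (simp add: euclidean_representation)
    next
      case False
      then have "\<psi> e s = 0" using \<psi> unfolding edgewise_poly_def by auto
      moreover have "m i e s = 0" if "i \<in> I" for i using False that by (auto simp: m_def I_def split: prod.splits)
      ultimately show ?thesis by simp
    qed
    then have "\<psi> = (\<Sum>i\<in>I. field_scale (c i) (m i))"
      by (simp add: fun_eq_iff sum_fun_apply2 field_scale_def)
    then show ?thesis
      by (simp add: fields.span_base fields.span_scale fields.span_sum)
  qed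
  moreover have "fields.span (m ` I) \<subseteq> edgewise_poly E h p"
    using m_in by (intro fields.span_minimal subspace_edgewise_poly) auto
  ultimately show ?thesis using \<open>finite I\<close> by blast
qed

subsection \<open>Inner products and derivatives of fields\<close>

lemma L2_inner_commute: "L2_inner G f g = L2_inner G g f"
  by (simp add: L2_inner_def inner_commute)

text \<open>End points are excluded since edgewise constant coefficients are arbitrary at the nodes.\<close>

lemma L2_inner_cong:
  assumes "\<And>e s. \<lbrakk>e \<in> edges G; s \<in> {0<..<len e}\<rbrakk> \<Longrightarrow> f e s \<bullet> g e s = f' e s \<bullet> g' e s"
  shows "L2_inner G f g = L2_inner G f' g'"
  unfolding L2_inner_def
proof (rule sum.cong[OF refl])
  fix e assume "e \<in> edges G"
  then show "integral {0..len e} (\<lambda>s. f e s \<bullet> g e s) = integral {0..len e} (\<lambda>s. f' e s \<bullet> g' e s)"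
    by (intro integral_spike[of "{0, len e}"]) (auto simp: assms)
qed

text \<open>Continuity up to the ends of every edge makes all products below integrable. It is kept
  apart from membership in \<open>V\<close> in order to cover derivatives, cross products and images
  under the coefficients as well.\<close>

definition edgewise_continuous :: "network \<Rightarrow> (edge \<Rightarrow> real \<Rightarrow> 'v::real_normed_vector) \<Rightarrow> bool" where
  "edgewise_continuous G f \<longleftrightarrow> (\<forall>e\<in>edges G. continuous_on {0..len e} (f e))"

lemma edgewise_continuous_linear_comb:
  "edgewise_continuous G f \<Longrightarrow> edgewise_continuous G g \<Longrightarrow>
    edgewise_continuous G (\<lambda>e s. r *\<^sub>R f e s + g e s)"
  by (auto simp: edgewise_continuous_def intro!: continuous_intros)

lemma edgewise_continuous_add:
  "edgewise_continuous G f \<Longrightarrow> edgewise_continuous G g \<Longrightarrow>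
    edgewise_continuous G (\<lambda>e s. f e s + g e s)"
  by (auto simp: edgewise_continuous_def intro!: continuous_intros)

lemma edgewise_continuous_linear:
  fixes f :: "edge \<Rightarrow> real \<Rightarrow> 'v::euclidean_space"
  assumes "edgewise_continuous G f" "\<And>e. e \<in> edges G \<Longrightarrow> linear (L e)"
  shows "edgewise_continuous G (\<lambda>e s. L e (f e s))"
  using assms linear_continuous_on_compose unfolding edgewise_continuous_def by blast

lemma edgewise_continuous_inner_integrable:
  "edgewise_continuous G f \<Longrightarrow> edgewise_continuous G g \<Longrightarrow> e \<in> edges G \<Longrightarrow>
    (\<lambda>s. f e s \<bullet> g e s) integrable_on {0..len e}"
  unfolding edgewise_continuous_def
  by (intro integrable_continuous_real continuous_on_inner) auto

lemma L2_inner_linear_left: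
  assumes "edgewise_continuous G f" "edgewise_continuous G g" "edgewise_continuous G k"
  shows "L2_inner G (\<lambda>e s. r *\<^sub>R f e s + g e s) k = r * L2_inner G f k + L2_inner G g k"
  unfolding L2_inner_def sum_distrib_left sum.distrib[symmetric]
proof (rule sum.cong[OF refl])
  fix e assume e: "e \<in> edges G"
  note i = edgewise_continuous_inner_integrable[OF _ _ e]
  have "integral {0..len e} (\<lambda>s. (r *\<^sub>R f e s + g e s) \<bullet> k e s)
      = integral {0..len e} (\<lambda>s. r * (f e s \<bullet> k e s) + g e s \<bullet> k e s)"
    by (simp add: inner_add_left)
  also have "\<dots> = integral {0..len e} (\<lambda>s. r * (f e s \<bullet> k e s)) + integral {0..len e} (\<lambda>s. g e s \<bullet> k e s)"
    using assms by (intro integral_add integrable_on_mult_right i)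
  finally show "integral {0..len e} (\<lambda>s. (r *\<^sub>R f e s + g e s) \<bullet> k e s) =
      r * integral {0..len e} (\<lambda>s. f e s \<bullet> k e s) + integral {0..len e} (\<lambda>s. g e s \<bullet> k e s)"
    by simp
qed

lemma L2_inner_linear_right:
  assumes "edgewise_continuous G f" "edgewise_continuous G g" "edgewise_continuous G k"
  shows "L2_inner G k (\<lambda>e s. r *\<^sub>R f e s + g e s) = r * L2_inner G k f + L2_inner G k g"
  using L2_inner_linear_left[OF assms] by (simp add: L2_inner_commute)

lemma L2_inner_add_left:
  assumes "edgewise_continuous G f" "edgewise_continuous G g" "edgewise_continuous G k"
  shows "L2_inner G (\<lambda>e s. f e s + g e s) k = L2_inner G f k + L2_inner G g k"
  using L2_inner_linear_left[OF assms, of 1] by simp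

lemma L2_inner_scale_left: "L2_inner G (\<lambda>e s. r *\<^sub>R f e s) k = r * L2_inner G f k"
  by (simp add: L2_inner_def sum_distrib_left)

lemma L2_inner_le:
  assumes "edgewise_continuous G f" "edgewise_continuous G f'" "edgewise_continuous G g" "edgewise_continuous G g'"
    and "\<And>e s. \<lbrakk>e \<in> edges G; s \<in> {0..len e}\<rbrakk> \<Longrightarrow> f e s \<bullet> f' e s \<le> k * (g e s \<bullet> g' e s)"
  shows "L2_inner G f f' \<le> k * L2_inner G g g'"
  unfolding L2_inner_def sum_distrib_left integral_mult_right[symmetric] using assms
  by (intro sum_mono integral_le integrable_on_mult_right edgewise_continuous_inner_integrable) auto

text \<open>No integrability is required: the integral of a non-integrable function is 0 by
  convention.\<close>

lemma integral_inner_self_nonneg: "0 \<le> integral S (\<lambda>s. f s \<bullet> f s)"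
  for f :: "real \<Rightarrow> 'v::real_inner"
  by (cases "(\<lambda>s. f s \<bullet> f s) integrable_on S")
     (auto simp: not_integrable_integral intro!: integral_nonneg)

lemma L2_inner_self_nonneg: "0 \<le> L2_inner G f f"
  unfolding L2_inner_def by (intro sum_nonneg integral_inner_self_nonneg)

text \<open>A sum of nonnegative edge integrals that is at most 0 has only zero terms, and a
  continuous nonnegative integrand with zero integral vanishes everywhere, end points
  included.\<close>

lemma L2_inner_self_eq_0:
  assumes "finite (edges G)" "edgewise_continuous G f" "L2_inner G f f \<le> 0"
    and "e \<in> edges G" "0 < len e" "s \<in> {0..len e}"
  shows "f e s = 0"
proof -
  let ?I = "\<lambda>e. integral {0..len e} (\<lambda>s. f e s \<bullet> f e s)"
  have "?I e \<ge> 0" for e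
    by (rule integral_inner_self_nonneg)
  moreover have "(\<Sum>e\<in>edges G. ?I e) = 0"
    using assms(3) L2_inner_self_nonneg[of G f] unfolding L2_inner_def by linarith
  ultimately have "?I e = 0" using assms by (simp add: sum_nonneg_eq_0_iff)
  moreover have "continuous_on {0..len e} (\<lambda>s. f e s \<bullet> f e s)"
    using assms by (auto simp: edgewise_continuous_def intro!: continuous_intros)
  ultimately show ?thesis using assms integral_eq_0_iff[of 0 "len e" "\<lambda>s. f e s \<bullet> f e s"] by simp
qed

text \<open>Expand the nonnegative square of \<open>g - \<delta> f\<close> and divide by
  \<delta>.\<close>

lemma L2_inner_young:
  assumes "edgewise_continuous G f" "edgewise_continuous G g" "0 < \<delta>"
  shows "2 * L2_inner G f g \<le> \<delta> * L2_inner G f f + L2_inner G g g / \<delta>"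
proof -
  let ?k = "\<lambda>e s. (-\<delta>) *\<^sub>R f e s + g e s"
  have k: "edgewise_continuous G ?k" using assms by (intro edgewise_continuous_linear_comb)
  have "0 \<le> L2_inner G ?k ?k" by (rule L2_inner_self_nonneg)
  also have "\<dots> = \<delta> * \<delta> * L2_inner G f f - 2 * \<delta> * L2_inner G f g + L2_inner G g g"
    using assms k
    by (simp only: L2_inner_linear_left L2_inner_linear_right) (simp add: L2_inner_commute[of G g f] algebra_simps)
  finally have "0 \<le> (\<delta> * \<delta> * L2_inner G f f - 2 * \<delta> * L2_inner G f g + L2_inner G g g) / \<delta>"
    using assms by simp
  then show ?thesis using assms by (simp add: field_simps)
qed

lemma L2_inner_young_abs:
  assumes "edgewise_continuous G f" "edgewise_continuous G g" "0 < \<delta>"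
  shows "2 * \<bar>L2_inner G f g\<bar> \<le> \<delta> * L2_inner G f f + L2_inner G g g / \<delta>"
proof -
  have "edgewise_continuous G (\<lambda>e s. (-1) *\<^sub>R f e s)"
    using assms by (auto simp: edgewise_continuous_def intro!: continuous_intros)
  from L2_inner_young[OF this assms(2,3)] L2_inner_young[OF assms] show ?thesis
    by (simp only: L2_inner_scale_left L2_inner_commute[of G f "\<lambda>e s. (-1) *\<^sub>R f e s"])
qed

section \<open>Derivatives and linear images of polynomial fields\<close>

lemma V_deriv:
  assumes "\<psi> \<in> V G p" "e \<in> edges G" "0 < len e"
  shows "\<exists>D. continuous_on {0..len e} D \<and>
    (\<forall>s\<in>{0..len e}. (\<psi> e has_vector_derivative D s) (at s within {0..len e}) \<and> dx \<psi> e s = D s)"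
proof -
  have "\<forall>b. \<exists>P::real poly. b \<in> Basis \<longrightarrow> (\<forall>s\<in>{0..len e}. \<psi> e s \<bullet> b = poly P s)"
    using assms unfolding V_def by blast
  then obtain P :: "vec6 \<Rightarrow> real poly" where
    P: "\<And>b s. b \<in> Basis \<Longrightarrow> s \<in> {0..len e} \<Longrightarrow> \<psi> e s \<bullet> b = poly (P b) s" by metis
  \<comment> \<open>Differentiation is done coordinatewise on the representing polynomials. The
    field agrees with them only on the edge, so the derivative is taken within the closed interval,
    one-sided at the ends.\<close>
  define D where "D = (\<lambda>s. \<Sum>b\<in>Basis. poly (pderiv (P b)) s *\<^sub>R b)"
  have d: "(\<psi> e has_vector_derivative D s) (at s within {0..len e})" if s: "s \<in> {0..len e}" for s
  proof (rule has_vector_derivative_transform[OF s])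
    show "\<psi> e x = (\<Sum>b\<in>Basis. poly (P b) x *\<^sub>R b)" if "x \<in> {0..len e}" for x
      using P that by (subst euclidean_representation[of "\<psi> e x", symmetric]) (rule sum.cong, auto)
    show "((\<lambda>x. \<Sum>b\<in>Basis. poly (P b) x *\<^sub>R b) has_vector_derivative D s) (at s within {0..len e})"
      unfolding D_def
      by (intro has_vector_derivative_sum)
         (auto intro!: derivative_eq_intros DERIV_subset[OF poly_DERIV])
  qed
  moreover have "continuous_on {0..len e} D" unfolding D_def by (intro continuous_intros)
  moreover have "dx \<psi> e s = D s" if "s \<in> {0..len e}" for s
    using d[OF that] assms(3) that vector_derivative_within_closed_interval unfolding dx_def by blast
  ultimately show ?thesis by blast
qed

lemma dx_linear_comb:
  assumes "\<psi> \<in> V G p" "\<phi> \<in> V G p" "e \<in> edges G" "0 < len e" "s \<in> {0..len e}"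
  shows "dx (\<lambda>e s. r *\<^sub>R \<psi> e s + \<phi> e s) e s = r *\<^sub>R dx \<psi> e s + dx \<phi> e s"
proof -
  have "(\<psi> e has_vector_derivative dx \<psi> e s) (at s within {0..len e})"
    "(\<phi> e has_vector_derivative dx \<phi> e s) (at s within {0..len e})"
    using V_deriv[of \<psi> G p e] V_deriv[of \<phi> G p e] assms by auto
  then have "((\<lambda>s. r *\<^sub>R \<psi> e s + \<phi> e s) has_vector_derivative r *\<^sub>R dx \<psi> e s + dx \<phi> e s) (at s within {0..len e})"
    by (auto intro!: derivative_eq_intros)
  then show ?thesis unfolding dx_def[of "\<lambda>e s. r *\<^sub>R \<psi> e s + \<phi> e s"]
    by (rule vector_derivative_within_closed_interval[OF assms(4,5)])
qed

lemma V_linear_comb: "\<psi> \<in> V G p \<Longrightarrow> \<phi> \<in> V G p \<Longrightarrow> (\<lambda>e s. r *\<^sub>R \<psi> e s + \<phi> e s) \<in> V G p"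
  unfolding V_eq_edgewise_poly by (rule edgewise_poly_linear_comb)

text \<open>Coordinates of the image are linear combinations of coordinate polynomials, so the
  degree does not grow. It places \<open>(2 / \<Delta>t) *\<^sub>R Ky e (Y e s)\<close>, the
  candidate for \<open>Z\<close>, in the discrete space; this relies on coefficients that are
  constant along the edge.\<close>

lemma V_linear_map:
  assumes "\<psi> \<in> V G p" "\<And>e. linear (L e)"
  shows "(\<lambda>e s. L e (\<psi> e s)) \<in> V G p"
proof -
  have poly: "\<exists>R::real poly. degree R \<le> p \<and> (\<forall>s\<in>{0..len e}. L e (\<psi> e s) \<bullet> c = poly R s)"
    if e: "e \<in> edges G" for e and c :: vec6
  proof -
    have "\<forall>b. \<exists>P::real poly. b \<in> Basis \<longrightarrow> degree P \<le> p \<and> (\<forall>s\<in>{0..len e}. \<psi> e s \<bullet> b = poly P s)"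
      using assms(1) e unfolding V_def by blast
    then obtain P :: "vec6 \<Rightarrow> real poly" where
      P: "\<And>b. b \<in> Basis \<Longrightarrow> degree (P b) \<le> p"
        "\<And>b s. b \<in> Basis \<Longrightarrow> s \<in> {0..len e} \<Longrightarrow> \<psi> e s \<bullet> b = poly (P b) s" by metis
    have "L e (\<psi> e s) \<bullet> c = poly (\<Sum>b\<in>Basis. smult (L e b \<bullet> c) (P b)) s" if "s \<in> {0..len e}" for s
    proof -
      have "L e (\<psi> e s) = L e (\<Sum>b\<in>Basis. (\<psi> e s \<bullet> b) *\<^sub>R b)" by (simp add: euclidean_representation)
      also have "\<dots> = (\<Sum>b\<in>Basis. (\<psi> e s \<bullet> b) *\<^sub>R L e b)"
        using assms(2) by (simp add: linear_sum linear_scale)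
      finally show ?thesis using P(2) that by (simp add: inner_sum_left poly_sum mult.commute)
    qed
    moreover have "degree (\<Sum>b\<in>Basis. smult (L e b \<bullet> c) (P b)) \<le> p"
      using P(1) by (intro degree_sum_le) (auto intro: order_trans[OF degree_smult_le])
    ultimately show ?thesis by blast
  qed
  have zero: "L e (\<psi> e s) = 0" if "e \<notin> edges G \<or> s \<notin> {0..len e}" for e s
  proof -
    have "\<psi> e s = 0" using assms(1) that unfolding V_def by blast
    then show ?thesis using assms(2)[of e] by (simp add: linear_0)
  qed
  show ?thesis unfolding V_def
    by (intro CollectI conjI ballI allI impI poly zero)
qed

text \<open>The test fields of both energy bounds are edgewise affine; this is where
  \<open>1 \<le> p\<close> enters.\<close>

lemma affine_field_in_V:
  assumes "1 \<le> p"
  shows "(\<lambda>e s. if e \<in> edges G \<and> s \<in> {0..len e} then u e + s *\<^sub>R v e else 0) \<in> V G p"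
  unfolding V_def
proof (intro CollectI conjI ballI allI impI)
  fix e and b :: vec6 assume "e \<in> edges G"
  then show "\<exists>P::real poly. degree P \<le> p \<and>
    (\<forall>s\<in>{0..len e}. (if e \<in> edges G \<and> s \<in> {0..len e} then u e + s *\<^sub>R v e else 0) \<bullet> b = poly P s)"
    using assms by (intro exI[of _ "[:u e \<bullet> b, v e \<bullet> b:]"]) (auto simp: inner_add_left)
qed auto

lemma dx_affine_field:
  assumes "e \<in> edges G" "0 < len e" "s \<in> {0..len e}"
  shows "dx (\<lambda>e s. if e \<in> edges G \<and> s \<in> {0..len e} then u e + s *\<^sub>R v e else 0) e s = v e"
proof -
  have "((\<lambda>s. if e \<in> edges G \<and> s \<in> {0..len e} then u e + s *\<^sub>R v e else 0) has_vector_derivative v e)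
      (at s within {0..len e})"
    by (rule has_vector_derivative_transform[OF assms(3), of _ "\<lambda>s. u e + s *\<^sub>R v e"])
       (use assms in \<open>auto intro!: derivative_eq_intros\<close>)
  then show ?thesis unfolding dx_def by (rule vector_derivative_within_closed_interval[OF assms(2,3)])
qed

section \<open>Bounds for the tangential cross product\<close>

lemma norm_tangent: "0 < len e \<Longrightarrow> norm (tangent e) = 1"
  by (simp add: tangent_def len_def dist_norm norm_minus_commute)

text \<open>By Lagrange's identity the squared norms of the cross product and of the component along
  the unit vector \<open>t\<close> add up to that of \<open>x\<close>.\<close>

lemma inner_cross3_self_le: "norm t = 1 \<Longrightarrow> cross3 t x \<bullet> cross3 t x \<le> x \<bullet> x"
  using norm_cross[of t x] by (simp add: power2_norm_eq_inner)

text \<open>The first component of \<open>i_cross q\<close> is zero and the second only sees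
  \<open>fst q\<close>. The constant 1 means that the coupling of forces and moments introduces no
  mesh-dependent factor.\<close>

lemma i_cross_inner_self_le: "0 < len e \<Longrightarrow> i_cross q e s \<bullet> i_cross q e s \<le> q e s \<bullet> q e s"
  using inner_cross3_self_le[OF norm_tangent, of e "fst (q e s)"] inner_ge_zero[of "snd (q e s)"]
    inner_ge_zero[of "fst (q e s)"]
  unfolding i_cross_def inner_prod_def fst_conv snd_conv inner_zero_left by linarith

lemma i_cross_linear_comb:
  "i_cross (\<lambda>e s. r *\<^sub>R \<psi> e s + \<phi> e s) e s = r *\<^sub>R i_cross \<psi> e s + i_cross \<phi> e s"
  by (simp add: i_cross_def cross_add_right cross_mult_right)

lemma edgewise_continuous_i_cross:
  assumes "edgewise_continuous G q" shows "edgewise_continuous G (i_cross q)"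
proof -
  have "linear (\<lambda>x::vec6. (0::real^3, cross3 (tangent e) (fst x)))" for e
    by (rule linearI) (simp_all add: cross_add_right cross_mult_right)
  from edgewise_continuous_linear[OF assms this] show ?thesis by (simp add: i_cross_def[abs_def])
qed

subsection \<open>The condensed problem\<close>

text \<open>\<open>Kq e\<close> and \<open>Ky e\<close> are the values of the coefficients inside
  the edge \<open>e\<close>. The upper bounds have the form \<open>|K x|^2 \<le> cu (x, K x)\<close>
  because this passes directly to the inverse maps and encodes what is needed of symmetry.\<close>

locale constant_coefficient_network =
  fixes G :: network and C :: material and Kq Ky :: "edge \<Rightarrow> vec6 \<Rightarrow> vec6" and cl cu :: real
    and p :: nat and \<tau> :: "edge \<Rightarrow> real" and \<Delta>t :: real
  assumes finite_edges: "finite (edges G)"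
    and edge_ends: "\<And>e. e \<in> edges G \<Longrightarrow> fst e \<in> nodes G \<and> snd e \<in> nodes G \<and> fst e \<noteq> snd e"
    and linear_Kq: "\<And>e. linear (Kq e)"
    and linear_Ky: "\<And>e. linear (Ky e)"
    and Cq_eq: "\<And>e s. \<lbrakk>e \<in> edges G; s \<in> {0<..<len e}\<rbrakk> \<Longrightarrow> Cq C (edge_point e s) = Kq e"
    and Cy_eq: "\<And>e s. \<lbrakk>e \<in> edges G; s \<in> {0<..<len e}\<rbrakk> \<Longrightarrow> Cy C (edge_point e s) = Ky e"
    and cl_pos: "0 < cl" and cu_pos: "0 < cu"
    and Kq_lower: "\<And>e x. e \<in> edges G \<Longrightarrow> cl * (x \<bullet> x) \<le> x \<bullet> Kq e x"
    and Ky_lower: "\<And>e x. e \<in> edges G \<Longrightarrow> cl * (x \<bullet> x) \<le> x \<bullet> Ky e x"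
    and Kq_upper: "\<And>e x. e \<in> edges G \<Longrightarrow> Kq e x \<bullet> Kq e x \<le> cu * (x \<bullet> Kq e x)"
    and Ky_upper: "\<And>e x. e \<in> edges G \<Longrightarrow> Ky e x \<bullet> Ky e x \<le> cu * (x \<bullet> Ky e x)"
    and p_ge_1: "1 \<le> p"
    and \<tau>_pos: "\<And>e. e \<in> edges G \<Longrightarrow> 0 < \<tau> e"
    and \<Delta>t_pos: "0 < \<Delta>t"
begin

lemma len_pos: "e \<in> edges G \<Longrightarrow> 0 < len e"
  using edge_ends by (simp add: len_def)

definition Aq :: "edge \<Rightarrow> vec6 \<Rightarrow> vec6" where "Aq e = inv (Kq e)"
definition Ay :: "edge \<Rightarrow> vec6 \<Rightarrow> vec6" where "Ay e = inv (Ky e)"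

text \<open>The forms contain \<open>inv\<close> of the coefficient maps, which is a two-sided
  inverse only for bijections. Coercivity gives a trivial kernel, and in finite dimension
  injectivity implies surjectivity.\<close>

lemma bij_of_coercive:
  fixes K :: "vec6 \<Rightarrow> vec6"
  assumes "linear K" "\<And>x. cl * (x \<bullet> x) \<le> x \<bullet> K x"
  shows "bij K"
proof -
  have "x = 0" if "K x = 0" for x
  proof -
    have "cl * (x \<bullet> x) \<le> 0" using assms(2)[of x] that by simp
    then show ?thesis using cl_pos by (metis inner_ge_zero inner_eq_zero_iff mult_le_0_iff not_le order_antisym)
  qed
  then have "inj K" using assms(1) linear_injective_0 by blast
  then show ?thesis using assms(1) linear_injective_imp_surjective by (blast intro: bijI)
qed

lemma Kq_Aq: "e \<in> edges G \<Longrightarrow> Kq e (Aq e x) = x"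
  using bij_of_coercive[OF linear_Kq Kq_lower, of e]
  by (simp add: Aq_def bij_is_surj surj_f_inv_f)

lemma Ky_Ay: "e \<in> edges G \<Longrightarrow> Ky e (Ay e x) = x" and Ay_Ky: "e \<in> edges G \<Longrightarrow> Ay e (Ky e x) = x"
  using bij_of_coercive[OF linear_Ky Ky_lower, of e]
  by (simp_all add: Ay_def bij_is_inj bij_is_surj surj_f_inv_f)

lemma linear_Aq: "e \<in> edges G \<Longrightarrow> linear (Aq e)"
  unfolding Aq_def using inj_linear_imp_inv_linear[OF linear_Kq bij_is_inj[OF bij_of_coercive[OF linear_Kq Kq_lower]]] .

lemma linear_Ay: "e \<in> edges G \<Longrightarrow> linear (Ay e)"
  unfolding Ay_def using inj_linear_imp_inv_linear[OF linear_Ky bij_is_inj[OF bij_of_coercive[OF linear_Ky Ky_lower]]] .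

text \<open>This and the next two bounds come from evaluating bounds for \<open>K\<close> at the
  preimage of \<open>x\<close>.\<close>

lemma Aq_lower: "e \<in> edges G \<Longrightarrow> cl * (Aq e x \<bullet> Aq e x) \<le> Aq e x \<bullet> x"
  using Kq_lower[of e "Aq e x"] by (simp add: Kq_Aq)

lemma Aq_upper: "e \<in> edges G \<Longrightarrow> x \<bullet> x \<le> cu * (Aq e x \<bullet> x)"
  using Kq_upper[of e "Aq e x"] by (simp add: Kq_Aq)

lemma Ay_upper: "e \<in> edges G \<Longrightarrow> x \<bullet> x \<le> cu * (Ay e x \<bullet> x)"
  using Ky_upper[of e "Ay e x"] by (simp add: Ky_Ay)

abbreviation "ip \<equiv> L2_inner G"
abbreviation "ec \<equiv> edgewise_continuous G"
abbreviation "VV \<equiv> V G p"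

lemma form_a_eq: "form_a G C q w = ip (\<lambda>e s. Aq e (q e s)) w"
  unfolding form_a_def by (rule L2_inner_cong) (simp add: Cq_eq Aq_def)

lemma form_d_eq: "form_d G C q w = ip (\<lambda>e s. Ay e (q e s)) w"
  unfolding form_d_def by (rule L2_inner_cong) (simp add: Cy_eq Ay_def)

lemma ec_V: assumes "q \<in> VV" shows "ec q"
  unfolding edgewise_continuous_def
proof
  fix e assume e: "e \<in> edges G"
  show "continuous_on {0..len e} (q e)"
    using V_deriv[OF assms e len_pos[OF e]] by (meson continuous_on_vector_derivative)
qed

lemma ec_dx: assumes "q \<in> VV" shows "ec (dx q)"
  unfolding edgewise_continuous_def
proof
  fix e assume e: "e \<in> edges G"
  obtain D where D: "continuous_on {0..len e} D" "\<forall>s\<in>{0..len e}. dx q e s = D s"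
    using V_deriv[OF assms e len_pos[OF e]] by auto
  show "continuous_on {0..len e} (dx q e)"
    by (rule continuous_on_eq[OF D(1)]) (simp add: D(2))
qed

lemma ec_i_cross: "q \<in> VV \<Longrightarrow> ec (i_cross q)"
  by (rule edgewise_continuous_i_cross[OF ec_V])

lemma ec_Aq: "q \<in> VV \<Longrightarrow> ec (\<lambda>e s. Aq e (q e s))"
  using ec_V linear_Aq by (rule edgewise_continuous_linear)

lemma ec_Ay: "q \<in> VV \<Longrightarrow> ec (\<lambda>e s. Ay e (q e s))"
  using ec_V linear_Ay by (rule edgewise_continuous_linear)

lemma ec_Ky: "q \<in> VV \<Longrightarrow> ec (\<lambda>e s. Ky e (q e s))"
  using ec_V linear_Ky by (rule edgewise_continuous_linear)

section \<open>Node sums and linearity of the forms\<close>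

lemma edge_inner_eq:
  "edge_inner G \<psi> \<phi> = (\<Sum>e\<in>edges G. \<psi> e (fst e) \<bullet> \<phi> e (fst e) + \<psi> e (snd e) \<bullet> \<phi> e (snd e))"
  unfolding edge_inner_def
proof (rule sum.cong[OF refl])
  fix e assume e: "e \<in> edges G"
  have "{n. (e, n) \<in> incidence G} = {fst e, snd e}"
    using e edge_ends[OF e] by (auto simp: incidence_def)
  then show "(\<Sum>n | (e, n) \<in> incidence G. \<psi> e n \<bullet> \<phi> e n)
      = \<psi> e (fst e) \<bullet> \<phi> e (fst e) + \<psi> e (snd e) \<bullet> \<phi> e (snd e)"
    using edge_ends[OF e] by simp
qed

lemma trace_at_ends:
  "e \<in> edges G \<Longrightarrow> trace_at w e (fst e) = w e 0"
  "trace_at w e (snd e) = w e (len e)"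
  using edge_ends by (auto simp: trace_at_def)

lemma nu_ends: "e \<in> edges G \<Longrightarrow> nu e (fst e) = -1" "nu e (snd e) = 1"
  using edge_ends by (auto simp: nu_def)

lemma edge_inner_linear_right:
  "edge_inner G \<psi> (\<lambda>e n. r *\<^sub>R f e n + g e n) = r * edge_inner G \<psi> f + edge_inner G \<psi> g"
  unfolding edge_inner_eq sum_distrib_left sum.distrib[symmetric]
  by (rule sum.cong) (simp_all add: inner_add_right algebra_simps)

lemma edge_inner_commute: "edge_inner G \<psi> \<phi> = edge_inner G \<phi> \<psi>"
  by (simp add: edge_inner_def inner_commute)

lemma edge_inner_linear_left:
  "edge_inner G (\<lambda>e n. r *\<^sub>R f e n + g e n) \<psi> = r * edge_inner G f \<psi> + edge_inner G g \<psi>"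
  by (simp add: edge_inner_commute[of _ \<psi>] edge_inner_linear_right)

lemma form_a_linear_left:
  assumes "q \<in> VV" "q' \<in> VV" "w \<in> VV"
  shows "form_a G C (\<lambda>e s. r *\<^sub>R q e s + q' e s) w = r * form_a G C q w + form_a G C q' w"
proof -
  have "form_a G C (\<lambda>e s. r *\<^sub>R q e s + q' e s) w = ip (\<lambda>e s. r *\<^sub>R Aq e (q e s) + Aq e (q' e s)) w"
    unfolding form_a_eq by (rule L2_inner_cong) (simp add: linear_Aq linear_add linear_scale)
  also have "\<dots> = r * form_a G C q w + form_a G C q' w"
    unfolding form_a_eq by (intro L2_inner_linear_left ec_Aq ec_V assms)
  finally show ?thesis .
qed

lemma form_a_linear_right:
  assumes "q \<in> VV" "q' \<in> VV" "w \<in> VV"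
  shows "form_a G C w (\<lambda>e s. r *\<^sub>R q e s + q' e s) = r * form_a G C w q + form_a G C w q'"
  unfolding form_a_eq by (intro L2_inner_linear_right ec_Aq ec_V assms)

lemma ec_D: "q \<in> VV \<Longrightarrow> ec (\<lambda>e s. dx q e s + i_cross q e s)"
  by (intro edgewise_continuous_add ec_dx ec_i_cross)

lemma form_b_linear_left:
  assumes "q \<in> VV" "q' \<in> VV" "w \<in> VV"
  shows "form_b G (\<lambda>e s. r *\<^sub>R q e s + q' e s) w = r * form_b G q w + form_b G q' w"
proof -
  have "ip (\<lambda>e s. dx (\<lambda>e s. r *\<^sub>R q e s + q' e s) e s + i_cross (\<lambda>e s. r *\<^sub>R q e s + q' e s) e s) w
     = ip (\<lambda>e s. r *\<^sub>R (dx q e s + i_cross q e s) + (dx q' e s + i_cross q' e s)) w"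
  proof (rule L2_inner_cong)
    fix e s assume "e \<in> edges G" "s \<in> {0<..<len e}"
    then have "dx (\<lambda>e s. r *\<^sub>R q e s + q' e s) e s = r *\<^sub>R dx q e s + dx q' e s"
      by (intro dx_linear_comb[OF assms(1,2)] len_pos) auto
    then show "(dx (\<lambda>e s. r *\<^sub>R q e s + q' e s) e s + i_cross (\<lambda>e s. r *\<^sub>R q e s + q' e s) e s) \<bullet> w e s
      = (r *\<^sub>R (dx q e s + i_cross q e s) + (dx q' e s + i_cross q' e s)) \<bullet> w e s"
      by (simp only: i_cross_linear_comb) (simp add: algebra_simps)
  qed
  also have "\<dots> = r * ip (\<lambda>e s. dx q e s + i_cross q e s) w + ip (\<lambda>e s. dx q' e s + i_cross q' e s) w"
    by (intro L2_inner_linear_left ec_D ec_V assms)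
  finally show ?thesis by (simp add: form_b_def)
qed

lemma form_b_linear_right:
  assumes "q \<in> VV" "q' \<in> VV" "w \<in> VV"
  shows "form_b G w (\<lambda>e s. r *\<^sub>R q e s + q' e s) = r * form_b G w q + form_b G w q'"
  using L2_inner_linear_right[OF ec_V ec_V ec_D, OF assms] by (simp add: form_b_def)

lemma mass_y_linear_left:
  assumes "q \<in> VV" "q' \<in> VV" "w \<in> VV"
  shows "ip (\<lambda>e s. Ky e (r *\<^sub>R q e s + q' e s)) w
    = r * ip (\<lambda>e s. Ky e (q e s)) w + ip (\<lambda>e s. Ky e (q' e s)) w"
  using L2_inner_linear_left[OF ec_Ky ec_Ky ec_V, OF assms, of r]
  by (simp add: linear_Ky linear_add linear_scale)

section \<open>Elimination of the third unknown\<close>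

definition condensed_solution :: "(point \<Rightarrow> vec6) \<Rightarrow> field6 \<Rightarrow> field6 \<Rightarrow> bool" where
  "condensed_solution lam Q Y \<longleftrightarrow> Q \<in> VV \<and> Y \<in> VV \<and>
     (\<forall>w\<in>VV. form_a G C Q w + form_b G w Y
        = - edge_inner G (\<lambda>e. lam) (\<lambda>e n. nu e n *\<^sub>R trace_at w e n)) \<and>
     (\<forall>w\<in>VV. - form_b G Q w
          + edge_inner G (\<lambda>e n. \<tau> e *\<^sub>R (trace_at Y e n - lam n)) (trace_at w)
          + 4 / \<Delta>t\<^sup>2 * ip (\<lambda>e s. Ky e (Y e s)) w = 0)"

lemma V_outside: "q \<in> VV \<Longrightarrow> e \<notin> edges G \<or> s \<notin> {0..len e} \<Longrightarrow> q e s = 0"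
  unfolding V_def by blast

lemma V_eqI:
  assumes "q \<in> VV" "q' \<in> VV" "\<And>e s. \<lbrakk>e \<in> edges G; s \<in> {0..len e}\<rbrakk> \<Longrightarrow> q e s = q' e s"
  shows "q = q'"
proof (intro ext)
  fix e s show "q e s = q' e s"
    by (cases "e \<in> edges G \<and> s \<in> {0..len e}") (use assms in \<open>auto simp: V_outside\<close>)
qed

text \<open>The third equation forces \<open>Z = (2 / \<Delta>t) K Y\<close> with
  \<open>K = Ky\<close>; inserting this into the second equation multiplies two factors
  \<open>2 / \<Delta>t\<close>, whence the coefficient \<open>4 / \<Delta>t\<^sup>2\<close>.\<close>

lemma local_solution_iff:
  "local_solution G C p \<tau> \<Delta>t lam (Q, Y, Z) \<longleftrightarrow>
     condensed_solution lam Q Y \<and> Z = (\<lambda>e s. (2 / \<Delta>t) *\<^sub>R Ky e (Y e s))"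
  (is "?L \<longleftrightarrow> ?R \<and> Z = ?Z")
proof -
  have Z_V: "?Z \<in> VV" if "Y \<in> VV"
    using that linear_compose_scale_right linear_Ky
    by (intro V_linear_map[of Y G p "\<lambda>e x. (2 / \<Delta>t) *\<^sub>R Ky e x"]) auto
  have Z_eq: "Z = ?Z"
    if V: "Y \<in> VV" "Z \<in> VV" and eq: "\<forall>w\<in>VV. - (2 / \<Delta>t) * ip Y w + form_d G C Z w = 0"
  proof (rule V_eqI)
    \<comment> \<open>Testing with the difference of \<open>Z\<close> and its candidate turns the
      third equation into the vanishing of the inverse-coefficient energy of that
      difference.\<close>
    let ?w = "\<lambda>e s. (-1) *\<^sub>R ?Z e s + Z e s"
    have w: "?w \<in> VV" using V Z_V by (intro V_linear_comb) auto
    have AY: "ip (\<lambda>e s. Ay e (?w e s)) ?w = ip (\<lambda>e s. (- (2 / \<Delta>t)) *\<^sub>R Y e s + Ay e (Z e s)) ?w"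
    proof (rule L2_inner_cong)
      fix e s assume "e \<in> edges G"
      then have "Ay e (?w e s) = (- (2 / \<Delta>t)) *\<^sub>R Y e s + Ay e (Z e s)"
        by (simp add: linear_Ay linear_diff linear_scale Ay_Ky)
      then show "Ay e (?w e s) \<bullet> ?w e s = ((- (2 / \<Delta>t)) *\<^sub>R Y e s + Ay e (Z e s)) \<bullet> ?w e s" by simp
    qed
    have "ip ?w ?w \<le> cu * ip (\<lambda>e s. Ay e (?w e s)) ?w"
      using Ay_upper by (intro L2_inner_le ec_V ec_Ay w) auto
    also have "\<dots> = cu * (- (2 / \<Delta>t) * ip Y ?w + form_d G C Z ?w)"
      unfolding AY form_d_eq L2_inner_linear_left[OF ec_V[OF V(1)] ec_Ay[OF V(2)] ec_V[OF w]] ..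
    also have "\<dots> = 0" using eq w by simp
    finally have "ip ?w ?w \<le> 0" .
    then show "Z e s = ?Z e s" if "e \<in> edges G" "s \<in> {0..len e}" for e s
      using L2_inner_self_eq_0[OF finite_edges ec_V[OF w], of e s] that len_pos by simp
  qed (use V Z_V in auto)
  have Z_mass: "2 / \<Delta>t * ip ?Z w = 4 / \<Delta>t\<^sup>2 * ip (\<lambda>e s. Ky e (Y e s)) w" for w
    by (simp add: L2_inner_scale_left power2_eq_square)
  have Z_third: "form_d G C ?Z w = 2 / \<Delta>t * ip Y w" for w
  proof -
    have "form_d G C ?Z w = ip (\<lambda>e s. (2 / \<Delta>t) *\<^sub>R Y e s) w"
      unfolding form_d_eq by (rule L2_inner_cong) (simp add: linear_Ay linear_scale Ay_Ky)
    then show ?thesis by (simp add: L2_inner_scale_left)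
  qed
  show ?thesis
  proof
    assume L: ?L
    then have "Z = ?Z" unfolding local_solution_def prod.case by (intro Z_eq) auto
    then show "?R \<and> Z = ?Z" using L Z_mass unfolding local_solution_def condensed_solution_def by auto
  next
    assume "?R \<and> Z = ?Z"
    then show ?L using Z_V Z_mass Z_third unfolding local_solution_def condensed_solution_def by auto
  qed
qed

section \<open>Energy identity and unique solvability\<close>

definition condensed_energy :: "(point \<Rightarrow> vec6) \<Rightarrow> field6 \<Rightarrow> field6 \<Rightarrow> real" where
  "condensed_energy lam Q Y = form_a G C Q Q
     + edge_inner G (\<lambda>e n. \<tau> e *\<^sub>R (trace_at Y e n - lam n)) (\<lambda>e n. trace_at Y e n - lam n)
     + 4 / \<Delta>t\<^sup>2 * ip (\<lambda>e s. Ky e (Y e s)) Y"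

text \<open>With \<open>w = Q\<close> in the first equation and \<open>w = Y\<close> in the second,
  the two occurrences of \<open>form_b G Q Y\<close> cancel. The penalty part of the flux, tested
  with \<open>lam\<close>, completes the penalty term to a square.\<close>

lemma condensed_energy_eq:
  assumes "condensed_solution lam Q Y"
  shows "- edge_inner G (\<lambda>e n. nu e n *\<^sub>R trace_at Q e n + \<tau> e *\<^sub>R (trace_at Y e n - lam n)) (\<lambda>e. lam)
    = condensed_energy lam Q Y"
proof -
  let ?t = "\<lambda>e n. \<tau> e *\<^sub>R (trace_at Y e n - lam n)"
  let ?q = "\<lambda>e n. nu e n *\<^sub>R trace_at Q e n"
  have 1: "form_a G C Q Q + form_b G Q Y = - edge_inner G (\<lambda>e. lam) ?q"
    and 2: "- form_b G Q Y + edge_inner G ?t (trace_at Y) + 4 / \<Delta>t\<^sup>2 * ip (\<lambda>e s. Ky e (Y e s)) Y = 0"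
    using assms unfolding condensed_solution_def by blast+
  have "edge_inner G ?t (\<lambda>e n. trace_at Y e n - lam n) = edge_inner G ?t (trace_at Y) - edge_inner G ?t (\<lambda>e. lam)"
    using edge_inner_linear_right[of ?t "-1" "\<lambda>e. lam" "trace_at Y"] by simp
  moreover have "edge_inner G (\<lambda>e n. ?q e n + ?t e n) (\<lambda>e. lam)
      = edge_inner G (\<lambda>e. lam) ?q + edge_inner G ?t (\<lambda>e. lam)"
    using edge_inner_linear_left[of 1 ?q ?t "\<lambda>e. lam"] by (simp add: edge_inner_commute)
  ultimately show ?thesis using 1 2 unfolding condensed_energy_def by linarith
qed

text \<open>Two controls extracted from \<open>form_a\<close> serve different ends: the first
  equation contains \<open>Aq Q\<close>, so this one is used for the lower energy bound, whereas
  \<open>form_a_upper\<close> controls \<open>Q\<close> itself, as the second equation requires. The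
  two bounds for \<open>Ky\<close> are divided likewise.\<close>

lemma form_a_lower: "q \<in> VV \<Longrightarrow> cl * ip (\<lambda>e s. Aq e (q e s)) (\<lambda>e s. Aq e (q e s)) \<le> form_a G C q q"
  using L2_inner_le[OF ec_Aq ec_Aq ec_Aq ec_V, of q q q q "1 / cl"] Aq_lower cl_pos
  by (simp add: form_a_eq field_simps)

lemma form_a_upper: "q \<in> VV \<Longrightarrow> ip q q \<le> cu * form_a G C q q"
  unfolding form_a_eq by (intro L2_inner_le ec_Aq ec_V Aq_upper)

lemma mass_y_lower: "q \<in> VV \<Longrightarrow> cl * ip q q \<le> ip (\<lambda>e s. Ky e (q e s)) q"
  using L2_inner_le[OF ec_V ec_V ec_Ky ec_V, of q q q q "1 / cl"] Ky_lower cl_pos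
  by (simp add: field_simps inner_commute)

lemma mass_y_upper:
  "q \<in> VV \<Longrightarrow> ip (\<lambda>e s. Ky e (q e s)) (\<lambda>e s. Ky e (q e s)) \<le> cu * ip (\<lambda>e s. Ky e (q e s)) q"
  by (intro L2_inner_le ec_Ky ec_V) (use Ky_upper in \<open>auto simp: inner_commute\<close>)

lemma penalty_nonneg: "0 \<le> edge_inner G (\<lambda>e n. \<tau> e *\<^sub>R f e n) f"
  unfolding edge_inner_eq using \<tau>_pos by (intro sum_nonneg) (auto simp: less_imp_le)

text \<open>All three summands are nonnegative, so each of them vanishes. With zero nodal data this
  definiteness gives both uniqueness and existence.\<close>

lemma condensed_energy_le_0:
  assumes "Q \<in> VV" "Y \<in> VV" "condensed_energy lam Q Y \<le> 0"
  shows "Q = (\<lambda>e s. 0)" "Y = (\<lambda>e s. 0)"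
proof -
  let ?M = "ip (\<lambda>e s. Ky e (Y e s)) Y"
  have a: "form_a G C Q Q \<ge> ip Q Q / cu" using form_a_upper[OF assms(1)] cu_pos by (simp add: field_simps)
  have m: "?M \<ge> cl * ip Y Y" using mass_y_lower[OF assms(2)] .
  have "0 \<le> ip Q Q / cu" "0 \<le> cl * ip Y Y" using L2_inner_self_nonneg cl_pos cu_pos by (simp_all add: less_imp_le)
  moreover have "0 \<le> ?M" using m calculation by linarith
  then have "0 \<le> 4 / \<Delta>t\<^sup>2 * ?M" by simp
  ultimately have "ip Q Q / cu \<le> 0" "4 / \<Delta>t\<^sup>2 * ?M \<le> 0"
    using assms(3) a penalty_nonneg[of "\<lambda>e n. trace_at Y e n - lam n"] unfolding condensed_energy_def by linarith+
  then have "ip Q Q \<le> 0" "?M \<le> 0" using cu_pos \<Delta>t_pos by (simp_all add: divide_le_0_iff mult_le_0_iff)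
  moreover have "ip Y Y \<le> 0" using m \<open>?M \<le> 0\<close> cl_pos by (smt (verit) mult_pos_pos)
  have zero: "q = (\<lambda>e s. 0)" if "q \<in> VV" "ip q q \<le> 0" for q
  proof (intro ext)
    fix e s show "q e s = 0"
      using L2_inner_self_eq_0[OF finite_edges ec_V[OF that(1)] that(2)] len_pos V_outside[OF that(1)]
      by metis
  qed
  show "Q = (\<lambda>e s. 0)" "Y = (\<lambda>e s. 0)"
    using zero assms(1,2) \<open>ip Q Q \<le> 0\<close> \<open>ip Y Y \<le> 0\<close> by blast+
qed

text \<open>The difference of two solutions solves the problem with zero nodal data, for which the
  energy identity gives energy 0.\<close>

lemma condensed_solution_unique:
  assumes "condensed_solution lam Q Y" "condensed_solution lam Q' Y'"
  shows "Q = Q' \<and> Y = Y'"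
proof -
  let ?Q = "\<lambda>e s. (-1) *\<^sub>R Q' e s + Q e s" and ?Y = "\<lambda>e s. (-1) *\<^sub>R Y' e s + Y e s"
  have V: "Q \<in> VV" "Y \<in> VV" "Q' \<in> VV" "Y' \<in> VV"
    using assms unfolding condensed_solution_def by auto
  have VD: "?Q \<in> VV" "?Y \<in> VV" by (rule V_linear_comb[OF V(3,1)], rule V_linear_comb[OF V(4,2)])
  have "condensed_solution (\<lambda>n. 0) ?Q ?Y"
    unfolding condensed_solution_def
  proof (intro conjI VD ballI)
    fix w assume w: "w \<in> VV"
    have "form_a G C Q w + form_b G w Y = - edge_inner G (\<lambda>e. lam) (\<lambda>e n. nu e n *\<^sub>R trace_at w e n)"
      "form_a G C Q' w + form_b G w Y' = - edge_inner G (\<lambda>e. lam) (\<lambda>e n. nu e n *\<^sub>R trace_at w e n)"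
      using assms w unfolding condensed_solution_def by blast+
    then show "form_a G C ?Q w + form_b G w ?Y = - edge_inner G (\<lambda>e n. 0) (\<lambda>e n. nu e n *\<^sub>R trace_at w e n)"
      unfolding form_a_linear_left[OF V(3,1) w] form_b_linear_right[OF V(4,2) w]
      by (simp add: edge_inner_def)
    have "edge_inner G (\<lambda>e n. \<tau> e *\<^sub>R (trace_at ?Y e n - 0)) (trace_at w)
      = edge_inner G (\<lambda>e n. (-1) *\<^sub>R (\<tau> e *\<^sub>R (trace_at Y' e n - lam n)) + \<tau> e *\<^sub>R (trace_at Y e n - lam n)) (trace_at w)"
      by (simp add: trace_at_def algebra_simps)
    also have "\<dots> = - edge_inner G (\<lambda>e n. \<tau> e *\<^sub>R (trace_at Y' e n - lam n)) (trace_at w)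
      + edge_inner G (\<lambda>e n. \<tau> e *\<^sub>R (trace_at Y e n - lam n)) (trace_at w)"
      by (subst edge_inner_linear_left) simp
    finally have t: "edge_inner G (\<lambda>e n. \<tau> e *\<^sub>R (trace_at ?Y e n - 0)) (trace_at w) = \<dots>" .
    have
      "- form_b G Q w + edge_inner G (\<lambda>e n. \<tau> e *\<^sub>R (trace_at Y e n - lam n)) (trace_at w)
          + 4 / \<Delta>t\<^sup>2 * ip (\<lambda>e s. Ky e (Y e s)) w = 0"
      "- form_b G Q' w + edge_inner G (\<lambda>e n. \<tau> e *\<^sub>R (trace_at Y' e n - lam n)) (trace_at w)
          + 4 / \<Delta>t\<^sup>2 * ip (\<lambda>e s. Ky e (Y' e s)) w = 0"
      using assms w unfolding condensed_solution_def by blast+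
    then show "- form_b G ?Q w + edge_inner G (\<lambda>e n. \<tau> e *\<^sub>R (trace_at ?Y e n - 0)) (trace_at w)
          + 4 / \<Delta>t\<^sup>2 * ip (\<lambda>e s. Ky e (?Y e s)) w = 0"
      unfolding form_b_linear_left[OF V(3,1) w] t mass_y_linear_left[OF V(4,2) w] ring_distribs by linarith
  qed
  from condensed_energy_eq[OF this] have "condensed_energy (\<lambda>n. 0) ?Q ?Y = 0"
    by (simp add: edge_inner_def)
  then have "?Q = (\<lambda>e s. 0)" "?Y = (\<lambda>e s. 0)" using condensed_energy_le_0[OF VD, of "\<lambda>n. 0"] by auto
  then show ?thesis by (simp add: fun_eq_iff)
qed

text \<open>The pair \<open>(Q, Y)\<close> is treated as one field with values in
  \<open>vec6 \<times> vec6\<close>, and both equations are added into a single variational problem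
  with a definite form.\<close>

lemma condensed_solution_exists: "\<exists>Q Y. condensed_solution lam Q Y"
proof -
  define W :: "(edge \<Rightarrow> real \<Rightarrow> vec6 \<times> vec6) set" where "W = edgewise_poly (edges G) len p"
  define q :: "(edge \<Rightarrow> real \<Rightarrow> vec6 \<times> vec6) \<Rightarrow> field6" where "q u = (\<lambda>e s. fst (u e s))" for u
  define y :: "(edge \<Rightarrow> real \<Rightarrow> vec6 \<times> vec6) \<Rightarrow> field6" where "y u = (\<lambda>e s. snd (u e s))" for u
  obtain S where S: "finite S" "W = fields.span S"
    using edgewise_poly_finite_span[OF finite_edges] unfolding W_def by blast
  have Vq: "q u \<in> VV" and Vy: "y u \<in> VV" if "u \<in> W" for u
  proof -
    have out: "u e s = 0" if "e \<notin> edges G \<or> s \<notin> {0..len e}" for e s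
      using \<open>u \<in> W\<close> that unfolding W_def edgewise_poly_def by blast
    have comp: "\<exists>P::real poly. degree P \<le> p \<and> (\<forall>s\<in>{0..len e}. u e s \<bullet> b = poly P s)"
      if "e \<in> edges G" "b \<in> Basis" for e b
      using \<open>u \<in> W\<close> that unfolding W_def edgewise_poly_def by blast
    have "\<exists>P::real poly. degree P \<le> p \<and> (\<forall>s\<in>{0..len e}. q u e s \<bullet> b = poly P s)"
      "\<exists>P::real poly. degree P \<le> p \<and> (\<forall>s\<in>{0..len e}. y u e s \<bullet> b = poly P s)"
      if "e \<in> edges G" "b \<in> Basis" for e b
      using comp[OF that(1), of "(b, 0)"] comp[OF that(1), of "(0, b)"] that(2)
      by (simp_all add: q_def y_def Basis_prod_def inner_prod_def)
    moreover have "q u e s = 0" "y u e s = 0" if "e \<notin> edges G \<or> s \<notin> {0..len e}" for e s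
      using out[OF that] by (simp_all add: q_def y_def)
    ultimately show "q u \<in> VV" "y u \<in> VV" unfolding V_def by blast+
  qed
  have zero_V: "(\<lambda>e s. 0) \<in> VV" unfolding V_def by (auto intro!: exI[of _ 0])
  have pair_W: "(\<lambda>e s. (w1 e s, w2 e s)) \<in> W" if "w1 \<in> VV" "w2 \<in> VV" for w1 w2
  proof -
    have "\<exists>P::real poly. degree P \<le> p \<and> (\<forall>s\<in>{0..len e}. (w1 e s, w2 e s) \<bullet> b = poly P s)"
      if e: "e \<in> edges G" and b: "b \<in> Basis" for e and b :: "vec6 \<times> vec6"
    proof -
      have *: "\<exists>P::real poly. degree P \<le> p \<and> (\<forall>s\<in>{0..len e}. w e s \<bullet> b = poly P s)"
        if "w \<in> VV" "b \<in> Basis" for w b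
        using that e unfolding V_def by blast
      from b consider b1 where "b1 \<in> Basis" "b = (b1, 0)" | b2 where "b2 \<in> Basis" "b = (0, b2)"
        unfolding Basis_prod_def by blast
      then show ?thesis
      proof cases
        case 1 then show ?thesis using *[OF \<open>w1 \<in> VV\<close> 1(1)] by simp
      next
        case 2 then show ?thesis using *[OF \<open>w2 \<in> VV\<close> 2(1)] by simp
      qed
    qed
    moreover have "(w1 e s, w2 e s) = 0" if "e \<notin> edges G \<or> s \<notin> {0..len e}" for e s
      using V_outside[OF \<open>w1 \<in> VV\<close> that] V_outside[OF \<open>w2 \<in> VV\<close> that] by (simp add: zero_prod_def)
    ultimately show ?thesis unfolding W_def edgewise_poly_def by blast
  qed
  have q_comb: "q (field_scale r u + v) = (\<lambda>e s. r *\<^sub>R q u e s + q v e s)"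
    and y_comb: "y (field_scale r u + v) = (\<lambda>e s. r *\<^sub>R y u e s + y v e s)" for r u v
    by (simp_all add: q_def y_def field_scale_def fun_eq_iff)
  define c where "c = 4 / \<Delta>t\<^sup>2"
  define t where "t = (\<lambda>Y e n. \<tau> e *\<^sub>R trace_at Y e n)"
  define N where "N = (\<lambda>w e n. nu e n *\<^sub>R trace_at w e n)"
  \<comment> \<open>The coupling through \<open>form_b\<close> is skew: it cancels for
    \<open>u = w\<close>, which leaves exactly the energy with zero nodal data. The part of the
    penalty that contains \<open>lam\<close> is moved to the right-hand side
    \<open>F\<close>.\<close>
  define B where "B = (\<lambda>u w. form_a G C (q u) (q w) + form_b G (q w) (y u) - form_b G (q u) (y w)
    + edge_inner G (t (y u)) (trace_at (y w)) + c * ip (\<lambda>e s. Ky e (y u e s)) (y w))"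
  define F where "F = (\<lambda>w. - edge_inner G (\<lambda>e. lam) (N (q w))
    + edge_inner G (\<lambda>e n. \<tau> e *\<^sub>R lam n) (trace_at (y w)))"
  have trace_comb: "trace_at (\<lambda>e s. r *\<^sub>R f e s + g e s) = (\<lambda>e n. r *\<^sub>R trace_at f e n + trace_at g e n)" for r f g
    by (simp add: trace_at_def fun_eq_iff)
  have t_comb: "t (\<lambda>e s. r *\<^sub>R f e s + g e s) = (\<lambda>e n. r *\<^sub>R t f e n + t g e n)"
    and N_comb: "N (\<lambda>e s. r *\<^sub>R f e s + g e s) = (\<lambda>e n. r *\<^sub>R N f e n + N g e n)" for r f g
    by (simp_all add: t_def N_def trace_at_def fun_eq_iff algebra_simps)
  have "\<exists>u\<in>fields.span S. \<forall>w\<in>fields.span S. B u w = F w"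
  proof (rule fields.span_definite_form_representer[OF S(1)], unfold S(2)[symmetric])
    fix r u v w assume V: "u \<in> W" "v \<in> W" "w \<in> W"
    note V' = Vq[OF V(1)] Vq[OF V(2)] Vq[OF V(3)] Vy[OF V(1)] Vy[OF V(2)] Vy[OF V(3)]
    show "B (field_scale r u + v) w = r * B u w + B v w"
      unfolding B_def q_comb y_comb t_comb
        form_a_linear_left[OF V'(1,2,3)] form_b_linear_left[OF V'(1,2,6)] form_b_linear_right[OF V'(4,5,3)]
        edge_inner_linear_left mass_y_linear_left[OF V'(4,5,6)]
      by (simp add: algebra_simps)
    show "B w (field_scale r u + v) = r * B w u + B w v"
      unfolding B_def q_comb y_comb trace_comb
        form_a_linear_right[OF V'(1,2,3)] form_b_linear_left[OF V'(1,2,6)] form_b_linear_right[OF V'(4,5,3)]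
        edge_inner_linear_right L2_inner_linear_right[OF ec_V[OF V'(4)] ec_V[OF V'(5)] ec_Ky[OF V'(6)]]
      by (simp add: algebra_simps)
  next
    fix r u v assume V: "u \<in> W" "v \<in> W"
    show "F (field_scale r u + v) = r * F u + F v"
      unfolding F_def q_comb y_comb trace_comb N_comb edge_inner_linear_right
      by (simp add: algebra_simps)
  next
    fix u assume u: "u \<in> W" "u \<noteq> 0"
    have "B u u = condensed_energy (\<lambda>n. 0) (q u) (y u)"
      unfolding B_def condensed_energy_def t_def c_def by simp
    moreover have "condensed_energy (\<lambda>n. 0) (q u) (y u) \<noteq> 0"
    proof
      assume "condensed_energy (\<lambda>n. 0) (q u) (y u) = 0"
      then have "q u = (\<lambda>e s. 0)" "y u = (\<lambda>e s. 0)"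
        using condensed_energy_le_0[OF Vq[OF u(1)] Vy[OF u(1)], of "\<lambda>n. 0"] by auto
      then have "fst (u e s) = 0" "snd (u e s) = 0" for e s
        unfolding q_def y_def by (auto dest: fun_cong)
      then have "u = 0" by (simp add: fun_eq_iff prod_eq_iff)
      then show False using u by simp
    qed
    ultimately show "B u u \<noteq> 0" by simp
  qed
  then obtain u where u: "u \<in> W" "\<And>w. w \<in> W \<Longrightarrow> B u w = F w" unfolding S(2)[symmetric] by blast
  have "condensed_solution lam (q u) (y u)"
    unfolding condensed_solution_def
  proof (intro conjI Vq Vy u(1) ballI)
    fix w assume w: "w \<in> VV"
    \<comment> \<open>Test pairs with one zero component separate the two equations again.\<close>
    have "B u (\<lambda>e s. (w e s, 0)) = F (\<lambda>e s. (w e s, 0))"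
      using u(2)[OF pair_W[OF w zero_V]] by simp
    then show "form_a G C (q u) w + form_b G w (y u) = - edge_inner G (\<lambda>e. lam) (\<lambda>e n. nu e n *\<^sub>R trace_at w e n)"
      unfolding B_def F_def N_def q_def[of "\<lambda>e s. (w e s, 0)"] y_def[of "\<lambda>e s. (w e s, 0)"]
      by (simp add: form_b_def L2_inner_def edge_inner_def trace_at_def)
    have "B u (\<lambda>e s. (0, w e s)) = F (\<lambda>e s. (0, w e s))"
      using u(2)[OF pair_W[OF zero_V w]] by simp
    \<comment> \<open>Follows from linearity without computing a derivative: the value equals twice
      itself.\<close>
    moreover have "form_b G (\<lambda>e s. 0) v = 0" if "v \<in> VV" for v
      using form_b_linear_left[OF zero_V zero_V that, of 1] by simp
    ultimately have "- form_b G (q u) w + edge_inner G (t (y u)) (trace_at w) + c * ip (\<lambda>e s. Ky e (y u e s)) w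
       = edge_inner G (\<lambda>e n. \<tau> e *\<^sub>R lam n) (trace_at w)"
      unfolding B_def F_def N_def q_def[of "\<lambda>e s. (0, w e s)"] y_def[of "\<lambda>e s. (0, w e s)"]
      using Vy[OF u(1)] by (simp add: form_a_def L2_inner_def edge_inner_def trace_at_def)
    moreover have "edge_inner G (\<lambda>e n. \<tau> e *\<^sub>R (trace_at (y u) e n - lam n)) (trace_at w)
      = edge_inner G (t (y u)) (trace_at w) - edge_inner G (\<lambda>e n. \<tau> e *\<^sub>R lam n) (trace_at w)"
      using edge_inner_linear_left[of "-1" "\<lambda>e n. \<tau> e *\<^sub>R lam n" "t (y u)" "trace_at w"]
      by (simp add: t_def algebra_simps)
    ultimately show "- form_b G (q u) w
        + edge_inner G (\<lambda>e n. \<tau> e *\<^sub>R (trace_at (y u) e n - lam n)) (trace_at w)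
        + 4 / \<Delta>t\<^sup>2 * ip (\<lambda>e s. Ky e (y u e s)) w = 0"
      unfolding c_def by linarith
  qed
  then show ?thesis by blast
qed

text \<open>Existence and uniqueness give the definite description in \<open>local_solver\<close>
  its value; the energy identity does the rest.\<close>

lemma A_hat_eq_condensed_energy:
  assumes "condensed_solution lam Q Y"
  shows "A_hat G C p \<tau> \<Delta>t lam lam = condensed_energy lam Q Y"
proof -
  have "local_solver G C p \<tau> \<Delta>t lam = (Q, Y, \<lambda>e s. (2 / \<Delta>t) *\<^sub>R Ky e (Y e s))"
    unfolding local_solver_def
  proof (rule the_equality)
    show "local_solution G C p \<tau> \<Delta>t lam (Q, Y, \<lambda>e s. (2 / \<Delta>t) *\<^sub>R Ky e (Y e s))"
      using assms by (simp add: local_solution_iff)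
    fix R assume R: "local_solution G C p \<tau> \<Delta>t lam R"
    obtain Q' Y' Z' where "R = (Q', Y', Z')" by (metis prod_cases3)
    with R show "R = (Q, Y, \<lambda>e s. (2 / \<Delta>t) *\<^sub>R Ky e (Y e s))"
      using condensed_solution_unique[OF assms, of Q' Y'] by (auto simp: local_solution_iff)
  qed
  then show ?thesis unfolding A_hat_def using condensed_energy_eq[OF assms] by simp
qed

section \<open>Affine test fields and integration by parts\<close>

lemma L2_inner_self_le_sum:
  assumes "ec f" "\<And>e s. \<lbrakk>e \<in> edges G; s \<in> {0..len e}\<rbrakk> \<Longrightarrow> f e s \<bullet> f e s \<le> k e"
  shows "ip f f \<le> (\<Sum>e\<in>edges G. len e * k e)"
  unfolding L2_inner_def
proof (rule sum_mono)
  fix e assume e: "e \<in> edges G"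
  have "integral {0..len e} (\<lambda>s. f e s \<bullet> f e s) \<le> integral {0..len e} (\<lambda>s. k e)"
    using assms e by (intro integral_le edgewise_continuous_inner_integrable) auto
  then show "integral {0..len e} (\<lambda>s. f e s \<bullet> f e s) \<le> len e * k e"
    using len_pos[OF e] by simp
qed

definition affine_field :: "(edge \<Rightarrow> vec6) \<Rightarrow> (edge \<Rightarrow> vec6) \<Rightarrow> field6" where
  "affine_field u v = (\<lambda>e s. if e \<in> edges G \<and> s \<in> {0..len e} then u e + s *\<^sub>R v e else 0)"

lemma affine_field_V: "affine_field u v \<in> VV"
  unfolding affine_field_def by (rule affine_field_in_V[OF p_ge_1])

lemma affine_field_apply: "e \<in> edges G \<Longrightarrow> s \<in> {0..len e} \<Longrightarrow> affine_field u v e s = u e + s *\<^sub>R v e"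
  by (simp add: affine_field_def)

lemma dx_affine: "e \<in> edges G \<Longrightarrow> s \<in> {0..len e} \<Longrightarrow> dx (affine_field u v) e s = v e"
  unfolding affine_field_def by (rule dx_affine_field[OF _ len_pos])

lemma affine_field_trace:
  assumes "e \<in> edges G"
  shows "trace_at (affine_field u v) e (fst e) = u e"
    "trace_at (affine_field u v) e (snd e) = u e + len e *\<^sub>R v e"
  using assms len_pos[OF assms] by (simp_all add: trace_at_ends affine_field_apply)

text \<open>The signs in \<open>nu\<close> are those of the two end point terms in the fundamental
  theorem of calculus.\<close>

lemma integration_by_parts:
  assumes "f \<in> VV" "g \<in> VV"
  shows "ip (dx f) g + ip f (dx g) = edge_inner G (\<lambda>e n. nu e n *\<^sub>R trace_at f e n) (trace_at g)"
  unfolding L2_inner_def edge_inner_eq sum.distrib[symmetric]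
proof (rule sum.cong[OF refl])
  fix e assume e: "e \<in> edges G"
  have d: "(h e has_vector_derivative dx h e s) (at s within {0..len e})"
    if "h \<in> VV" "s \<in> {0..len e}" for h s
    using V_deriv[OF that(1) e len_pos[OF e]] that(2) by auto
  have "((\<lambda>s. f e s \<bullet> dx g e s + dx f e s \<bullet> g e s) has_integral (f e (len e) \<bullet> g e (len e) - f e 0 \<bullet> g e 0)) {0..len e}"
    using len_pos[OF e]
    by (intro fundamental_theorem_of_calculus bounded_bilinear.has_vector_derivative[OF bounded_bilinear_inner]
        d assms) auto
  then have "integral {0..len e} (\<lambda>s. f e s \<bullet> dx g e s + dx f e s \<bullet> g e s) = f e (len e) \<bullet> g e (len e) - f e 0 \<bullet> g e 0"
    by (rule integral_unique)
  moreover have "integral {0..len e} (\<lambda>s. f e s \<bullet> dx g e s + dx f e s \<bullet> g e s)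
      = integral {0..len e} (\<lambda>s. f e s \<bullet> dx g e s) + integral {0..len e} (\<lambda>s. dx f e s \<bullet> g e s)"
    by (intro integral_add edgewise_continuous_inner_integrable[of G] ec_V ec_dx assms e)
  ultimately show "integral {0..len e} (\<lambda>s. dx f e s \<bullet> g e s) + integral {0..len e} (\<lambda>s. f e s \<bullet> dx g e s)
      = (nu e (fst e) *\<^sub>R trace_at f e (fst e)) \<bullet> trace_at g e (fst e)
        + (nu e (snd e) *\<^sub>R trace_at f e (snd e)) \<bullet> trace_at g e (snd e)"
    using e by (simp add: trace_at_ends nu_ends)
qed

lemma ip_i_cross_self_le: "q \<in> VV \<Longrightarrow> ip (i_cross q) (i_cross q) \<le> ip q q"
  using L2_inner_le[OF ec_i_cross ec_i_cross ec_V ec_V, of q q q q 1] i_cross_inner_self_le len_pos by auto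

lemma inner_add_self_le: "(a + b) \<bullet> (a + b) \<le> 2 * (a \<bullet> a + b \<bullet> b)" for a b :: "'v::real_inner"
  using inner_ge_zero[of "a - b"] by (simp add: inner_add_left inner_add_right inner_diff_left inner_diff_right inner_commute)

lemma inner_lincomb_self_le:
  "(r *\<^sub>R a + s *\<^sub>R b) \<bullet> (r *\<^sub>R a + s *\<^sub>R b) \<le> 2 * (r\<^sup>2 * (a \<bullet> a) + s\<^sup>2 * (b \<bullet> b))" for a b :: "'v::real_inner"
  using inner_add_self_le[of "r *\<^sub>R a" "s *\<^sub>R b"] by (simp add: power2_eq_square mult.assoc)

subsection \<open>Energy bounds\<close>

text \<open>The constant field \<open>w\<close> equals the nodal difference divided by the length.
  Its derivative vanishes, so only the cross product survives in \<open>form_b\<close>, and both the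
  boundary pairing and the bound for \<open>ip w w\<close> equal
  \<open>2 * L_graph G lam lam\<close>.\<close>

lemma L_graph_le:
  assumes "condensed_solution lam Q Y"
  shows "L_graph G lam lam \<le> ip (\<lambda>e s. Aq e (Q e s)) (\<lambda>e s. Aq e (Q e s)) + ip Y Y"
proof -
  let ?P = "\<lambda>e s. Aq e (Q e s)"
  define \<delta> where "\<delta> e = lam (snd e) - lam (fst e)" for e :: edge
  define w where "w = affine_field (\<lambda>e. inverse (len e) *\<^sub>R \<delta> e) (\<lambda>e. 0)"
  have w: "w \<in> VV" unfolding w_def by (rule affine_field_V)
  have QY: "Q \<in> VV" "Y \<in> VV" using assms unfolding condensed_solution_def by auto
  have L: "2 * L_graph G lam lam = (\<Sum>e\<in>edges G. inverse (len e) * (\<delta> e \<bullet> \<delta> e))"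
    unfolding L_graph_def sum_distrib_left
    by (rule sum.cong) (simp_all add: \<delta>_def inner_diff_left inner_diff_right)
  have "edge_inner G (\<lambda>e. lam) (\<lambda>e n. nu e n *\<^sub>R trace_at w e n) = 2 * L_graph G lam lam"
    unfolding L edge_inner_eq
    by (rule sum.cong) (simp_all add: nu_ends w_def affine_field_trace \<delta>_def inner_diff_left inner_diff_right algebra_simps)
  moreover have "form_b G w Y = - ip (i_cross w) Y"
    unfolding form_b_def w_def by (intro arg_cong[where f = uminus] L2_inner_cong) (simp add: dx_affine)
  ultimately have "ip ?P w - ip (i_cross w) Y = - (2 * L_graph G lam lam)"
    using assms w unfolding condensed_solution_def form_a_eq by fastforce
  moreover have "ip w w \<le> 2 * L_graph G lam lam"
  proof -
    have "ip w w \<le> (\<Sum>e\<in>edges G. len e * (inverse (len e) * (inverse (len e) * (\<delta> e \<bullet> \<delta> e))))"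
      by (rule L2_inner_self_le_sum[OF ec_V[OF w]]) (simp add: w_def affine_field_apply)
    also have "\<dots> = 2 * L_graph G lam lam"
      unfolding L by (rule sum.cong) (use len_pos in force)+
    finally show ?thesis .
  qed
  \<comment> \<open>Twice the identity has four copies of \<open>L_graph\<close> on one side; each
    of the two Young estimates returns one copy. Two copies remain, and halving gives the claim with
    constant 1.\<close>
  moreover have "2 * \<bar>ip ?P w\<bar> \<le> 2 * ip ?P ?P + ip w w / 2"
    by (rule L2_inner_young_abs[OF ec_Aq[OF QY(1)] ec_V[OF w]]) simp
  moreover have "2 * \<bar>ip (i_cross w) Y\<bar> \<le> 1/2 * ip (i_cross w) (i_cross w) + ip Y Y / (1/2)"
    by (rule L2_inner_young_abs[OF ec_i_cross[OF w] ec_V[OF QY(2)]]) simp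
  moreover note ip_i_cross_self_le[OF w]
  ultimately show ?thesis by simp
qed

text \<open>The length factor in the test field yields the mass weights in the boundary pairing and
  keeps \<open>w\<close> of order \<open>H\<close>, while its derivative stays of order 1. Hence all
  volume terms can be absorbed into \<open>M_graph\<close>.\<close>

lemma M_graph_le:
  assumes "condensed_solution lam Q Y" "0 < H" "\<And>e. e \<in> edges G \<Longrightarrow> len e \<le> H"
  shows "M_graph G lam lam \<le> 4 * (H\<^sup>2 * ip (\<lambda>e s. Aq e (Q e s)) (\<lambda>e s. Aq e (Q e s)) + ip Y Y + H\<^sup>2 * ip Y Y)"
proof -
  let ?P = "\<lambda>e s. Aq e (Q e s)"
  let ?i = "\<lambda>e. lam (fst e)" and ?j = "\<lambda>e. lam (snd e)"
  let ?M = "M_graph G lam lam"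
  \<comment> \<open>The slope leads from \<open>- len e *\<^sub>R ?i e\<close> at the start to
    \<open>len e *\<^sub>R ?j e\<close> at the end, so the signs match \<open>nu\<close>.\<close>
  define w where "w = affine_field (\<lambda>e. - (len e *\<^sub>R ?i e)) (\<lambda>e. ?i e + ?j e)"
  have w: "w \<in> VV" unfolding w_def by (rule affine_field_V)
  have QY: "Q \<in> VV" "Y \<in> VV" using assms(1) unfolding condensed_solution_def by auto
  have M: "k * ?M = (\<Sum>e\<in>edges G. len e * (k / 2 * (?i e \<bullet> ?i e + ?j e \<bullet> ?j e)))" for k
    unfolding M_graph_def sum_distrib_left by (rule sum.cong) (simp_all add: algebra_simps)
  have "edge_inner G (\<lambda>e. lam) (\<lambda>e n. nu e n *\<^sub>R trace_at w e n) = 2 * ?M"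
    unfolding M edge_inner_eq
    by (rule sum.cong) (simp_all add: nu_ends w_def affine_field_trace inner_diff_right inner_add_right algebra_simps)
  moreover have "form_b G w Y = - (ip (dx w) Y + ip (i_cross w) Y)"
    unfolding form_b_def by (simp only: L2_inner_add_left[OF ec_dx[OF w] ec_i_cross[OF w] ec_V[OF QY(2)]])
  moreover have "form_a G C Q w + form_b G w Y = - edge_inner G (\<lambda>e. lam) (\<lambda>e n. nu e n *\<^sub>R trace_at w e n)"
    using assms(1) w unfolding condensed_solution_def by blast
  ultimately have "2 * ?M = ip (dx w) Y + ip (i_cross w) Y - ip ?P w"
    unfolding form_a_eq by linarith
  moreover have ww: "ip w w \<le> 4 * H\<^sup>2 * ?M"
    unfolding M
  proof (rule L2_inner_self_le_sum[OF ec_V[OF w]])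
    fix e s assume e: "e \<in> edges G" and s: "s \<in> {0..len e}"
    have "w e s = (s - len e) *\<^sub>R ?i e + s *\<^sub>R ?j e"
      using e s by (simp add: w_def affine_field_apply algebra_simps)
    then have "w e s \<bullet> w e s \<le> 2 * ((len e - s)\<^sup>2 * (?i e \<bullet> ?i e) + s\<^sup>2 * (?j e \<bullet> ?j e))"
      unfolding power2_commute[of "len e"] by (simp only: inner_lincomb_self_le)
    also have "\<dots> \<le> 2 * (H\<^sup>2 * (?i e \<bullet> ?i e) + H\<^sup>2 * (?j e \<bullet> ?j e))"
      using s assms(3)[OF e] by (intro mult_left_mono add_mono mult_right_mono power_mono) auto
    finally show "w e s \<bullet> w e s \<le> 4 * H\<^sup>2 / 2 * (?i e \<bullet> ?i e + ?j e \<bullet> ?j e)"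
      by (simp add: algebra_simps)
  qed
  moreover have "ip (dx w) (dx w) \<le> 4 * ?M"
    unfolding M
    using inner_add_self_le
    by (intro L2_inner_self_le_sum[OF ec_dx[OF w]]) (simp add: w_def dx_affine)
  \<comment> \<open>The three Young weights return \<open>?M / 2\<close> each. Of four copies of
    \<open>?M\<close>, five halves remain against the factor 8; the resulting \<open>16/5\<close> is
    rounded up to 4, using that the remaining terms are nonnegative.\<close>
  moreover have "2 * \<bar>ip ?P w\<bar> \<le> 8 * H\<^sup>2 * ip ?P ?P + ip w w / (8 * H\<^sup>2)"
    by (rule L2_inner_young_abs[OF ec_Aq[OF QY(1)] ec_V[OF w]]) (use assms in simp)
  moreover have "2 * \<bar>ip Y (dx w)\<bar> \<le> 8 * ip Y Y + ip (dx w) (dx w) / 8"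
    by (rule L2_inner_young_abs[OF ec_V[OF QY(2)] ec_dx[OF w]]) simp
  moreover have "2 * \<bar>ip Y (i_cross w)\<bar> \<le> 8 * H\<^sup>2 * ip Y Y + ip (i_cross w) (i_cross w) / (8 * H\<^sup>2)"
    by (rule L2_inner_young_abs[OF ec_V[OF QY(2)] ec_i_cross[OF w]]) (use assms in simp)
  moreover have "ip w w / (8 * H\<^sup>2) \<le> 1/2 * ?M"
    using ww assms(2) by (simp add: field_simps)
  moreover have "ip (i_cross w) (i_cross w) / (8 * H\<^sup>2) \<le> ip w w / (8 * H\<^sup>2)"
    by (rule divide_right_mono[OF ip_i_cross_self_le[OF w]]) simp
  moreover have "0 \<le> H\<^sup>2 * ip ?P ?P" "0 \<le> H\<^sup>2 * ip Y Y" "0 \<le> ip Y Y"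
    using L2_inner_self_nonneg by simp_all
  ultimately show ?thesis
    using L2_inner_commute[of G Y "i_cross w"] L2_inner_commute[of G Y "dx w"]
    unfolding distrib_left by linarith
qed

text \<open>The restriction on the mesh enters through \<open>M_graph_le\<close> with
  \<open>H = Cs * \<Delta>t\<close>, which turns \<open>H\<^sup>2 / \<Delta>t\<^sup>2\<close> into
  \<open>Cs\<^sup>2\<close>.\<close>

lemma condensed_energy_lower:
  assumes "condensed_solution lam Q Y" "0 < Cs" "\<Delta>t \<le> T" "\<And>e. e \<in> edges G \<Longrightarrow> len e \<le> Cs * \<Delta>t"
  shows "cl / (5 + 4 * Cs\<^sup>2 + 4 * Cs\<^sup>2 * T\<^sup>2 + T\<^sup>2) * (M_graph G lam lam / \<Delta>t\<^sup>2 + L_graph G lam lam)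
    \<le> condensed_energy lam Q Y"
proof -
  define P where "P = ip (\<lambda>e s. Aq e (Q e s)) (\<lambda>e s. Aq e (Q e s))"
  \<comment> \<open>The scaling is that of the mass term in the energy, which carries the factor
    \<open>4 / \<Delta>t\<^sup>2\<close>.\<close>
  define N where "N = ip Y Y / \<Delta>t\<^sup>2"
  \<comment> \<open>The sum of the coefficients that \<open>P\<close> and \<open>N\<close> receive
    below, so that it dominates each of them.\<close>
  let ?K = "5 + 4 * Cs\<^sup>2 + 4 * Cs\<^sup>2 * T\<^sup>2 + T\<^sup>2"
  have pos: "0 \<le> P" "0 \<le> N" unfolding P_def N_def by (simp_all add: L2_inner_self_nonneg)
  have Y: "ip Y Y = \<Delta>t\<^sup>2 * N" using \<Delta>t_pos by (simp add: N_def)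
  have "\<Delta>t\<^sup>2 \<le> T\<^sup>2" using assms(3) \<Delta>t_pos by (intro power_mono) auto
  then have TN: "\<Delta>t\<^sup>2 * N \<le> T\<^sup>2 * N" using pos by (intro mult_right_mono)
  have QY: "Q \<in> VV" "Y \<in> VV" using assms(1) unfolding condensed_solution_def by auto
  have "M_graph G lam lam \<le> 4 * ((Cs * \<Delta>t)\<^sup>2 * P + ip Y Y + (Cs * \<Delta>t)\<^sup>2 * ip Y Y)"
    unfolding P_def by (rule M_graph_le[OF assms(1)]) (use assms \<Delta>t_pos in auto)
  then have "M_graph G lam lam / \<Delta>t\<^sup>2 \<le> 4 * (Cs\<^sup>2 * P + N + Cs\<^sup>2 * (\<Delta>t\<^sup>2 * N))"
    using \<Delta>t_pos unfolding Y by (simp add: field_simps)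
  also have "\<dots> \<le> 4 * (Cs\<^sup>2 * P + N + Cs\<^sup>2 * (T\<^sup>2 * N))"
    using TN by (intro mult_left_mono add_mono order_refl) auto
  finally have M: "M_graph G lam lam / \<Delta>t\<^sup>2 \<le> 4 * (Cs\<^sup>2 * P + N + Cs\<^sup>2 * (T\<^sup>2 * N))" .
  have L: "L_graph G lam lam \<le> P + T\<^sup>2 * N"
    using L_graph_le[OF assms(1)] TN unfolding Y P_def by linarith
  have nonneg: "0 \<le> Cs\<^sup>2" "0 \<le> Cs\<^sup>2 * T\<^sup>2" "0 \<le> T\<^sup>2" by simp_all
  have "M_graph G lam lam / \<Delta>t\<^sup>2 + L_graph G lam lam \<le> (4 * Cs\<^sup>2 + 1) * P + (4 + 4 * Cs\<^sup>2 * T\<^sup>2 + T\<^sup>2) * N"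
    using M L by (simp add: algebra_simps)
  also have "\<dots> \<le> ?K * P + ?K * N" using pos nonneg
    by (intro add_mono[of _ "?K * P" _ "?K * N"] mult_right_mono) linarith+
  finally have "M_graph G lam lam / \<Delta>t\<^sup>2 + L_graph G lam lam \<le> ?K * (P + N)" by (simp add: algebra_simps)
  moreover have "0 < ?K" using nonneg by linarith
  ultimately have "cl / ?K * (M_graph G lam lam / \<Delta>t\<^sup>2 + L_graph G lam lam) \<le> cl / ?K * (?K * (P + N))"
    using cl_pos by (intro mult_left_mono) auto
  also have "\<dots> = cl * (P + N)" using \<open>0 < ?K\<close> by simp
  also have "\<dots> \<le> cl * P + 4 * (cl * N)" using pos cl_pos by (simp add: algebra_simps)
  also have "cl * P \<le> form_a G C Q Q" unfolding P_def by (rule form_a_lower[OF QY(1)])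
  also have "4 * (cl * N) \<le> 4 / \<Delta>t\<^sup>2 * ip (\<lambda>e s. Ky e (Y e s)) Y"
    using mass_y_lower[OF QY(2)] \<Delta>t_pos by (simp add: N_def divide_right_mono)
  finally show ?thesis
    using penalty_nonneg[of "\<lambda>e n. trace_at Y e n - lam n"] unfolding condensed_energy_def by linarith
qed

text \<open>The interpolant \<open>w\<close> has trace \<open>lam\<close>, so the penalty in the
  tested second equation is the one in the energy identity and drops out exactly. Neither \<tau> nor
  the mesh size therefore appears in the bound.\<close>

lemma condensed_energy_upper:
  assumes "condensed_solution lam Q Y" "\<Delta>t \<le> T"
  shows "condensed_energy lam Q Y
    \<le> cu * (16 + 8 * T\<^sup>2) * (M_graph G lam lam / \<Delta>t\<^sup>2 + L_graph G lam lam)"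
proof -
  let ?i = "\<lambda>e. lam (fst e)" and ?j = "\<lambda>e. lam (snd e)"
  let ?M = "M_graph G lam lam" and ?L = "L_graph G lam lam"
  let ?KY = "\<lambda>e s. Ky e (Y e s)"
  let ?X = "condensed_energy lam Q Y"
  define w where "w = affine_field ?i (\<lambda>e. inverse (len e) *\<^sub>R (?j e - ?i e))"
  have w: "w \<in> VV" unfolding w_def by (rule affine_field_V)
  have QY: "Q \<in> VV" "Y \<in> VV" using assms(1) unfolding condensed_solution_def by auto
  have tw: "trace_at w e (fst e) = ?i e" "trace_at w e (snd e) = ?j e" if "e \<in> edges G" for e
    using len_pos[OF that] that by (simp_all add: w_def affine_field_trace)
  have tw': "edge_inner G f (trace_at w) = edge_inner G f (\<lambda>e. lam)" for f
    unfolding edge_inner_eq by (rule sum.cong) (simp_all add: tw)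
  let ?t = "\<lambda>e n. \<tau> e *\<^sub>R (trace_at Y e n - lam n)"
  let ?q = "\<lambda>e n. nu e n *\<^sub>R trace_at Q e n"
  have "?X = - edge_inner G ?q (\<lambda>e. lam) - edge_inner G ?t (\<lambda>e. lam)"
    using condensed_energy_eq[OF assms(1)] edge_inner_linear_left[of 1 ?q ?t "\<lambda>e. lam"] by simp
  moreover have "- form_b G Q w + edge_inner G ?t (trace_at w) + 4 / \<Delta>t\<^sup>2 * ip ?KY w = 0"
    using assms(1) w unfolding condensed_solution_def by blast
  moreover have "form_b G Q w = - (ip (dx Q) w + ip (i_cross Q) w)"
    unfolding form_b_def by (simp only: L2_inner_add_left[OF ec_dx[OF QY(1)] ec_i_cross[OF QY(1)] ec_V[OF w]])
  moreover have "ip (dx Q) w + ip Q (dx w) = edge_inner G ?q (\<lambda>e. lam)"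
    using integration_by_parts[OF QY(1) w] unfolding tw' .
  ultimately have X: "?X = - ip Q (dx w) + ip (i_cross Q) w + 4 / \<Delta>t\<^sup>2 * ip ?KY w"
    unfolding tw' by linarith
  have M: "k * ?M = (\<Sum>e\<in>edges G. len e * (k / 2 * (?i e \<bullet> ?i e + ?j e \<bullet> ?j e)))" for k
    unfolding M_graph_def sum_distrib_left by (rule sum.cong) (simp_all add: algebra_simps)
  have ww: "ip w w \<le> 4 * ?M"
    unfolding M
  proof (rule L2_inner_self_le_sum[OF ec_V[OF w]])
    fix e s assume e: "e \<in> edges G" and s: "s \<in> {0..len e}"
    define r where "r = s / len e"
    have r: "0 \<le> r" "r \<le> 1" using s len_pos[OF e] by (auto simp: r_def)
    have "w e s = (1 - r) *\<^sub>R ?i e + r *\<^sub>R ?j e"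
      using e s by (simp add: w_def affine_field_apply r_def algebra_simps divide_inverse)
    then have "w e s \<bullet> w e s \<le> 2 * ((1 - r)\<^sup>2 * (?i e \<bullet> ?i e) + r\<^sup>2 * (?j e \<bullet> ?j e))"
      by (simp only: inner_lincomb_self_le)
    also have "\<dots> \<le> 2 * (1 * (?i e \<bullet> ?i e) + 1 * (?j e \<bullet> ?j e))"
      using r by (intro mult_left_mono add_mono mult_right_mono) (auto intro: power_le_one)
    finally show "w e s \<bullet> w e s \<le> 4 / 2 * (?i e \<bullet> ?i e + ?j e \<bullet> ?j e)" by simp
  qed
  have dd: "ip (dx w) (dx w) \<le> 2 * ?L"
  proof -
    have "ip (dx w) (dx w)
        \<le> (\<Sum>e\<in>edges G. len e * (inverse (len e) * (inverse (len e) * ((?j e - ?i e) \<bullet> (?j e - ?i e)))))"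
      by (rule L2_inner_self_le_sum[OF ec_dx[OF w]]) (simp add: w_def dx_affine)
    also have "\<dots> = 2 * ?L"
      unfolding L_graph_def sum_distrib_left
    proof (rule sum.cong[OF refl])
      fix e assume "e \<in> edges G"
      then have "len e * (inverse (len e) * z) = z" for z using len_pos[of e] by simp
      then show "len e * (inverse (len e) * (inverse (len e) * ((?j e - ?i e) \<bullet> (?j e - ?i e))))
        = 2 * (1/2 * inverse (len e) * ((?i e - ?j e) \<bullet> (?i e - ?j e)))"
        by (simp only:) (simp add: inner_diff_left inner_diff_right algebra_simps)
    qed
    finally show ?thesis .
  qed
  let ?a = "form_a G C Q Q" and ?m = "ip ?KY Y"
  \<comment> \<open>The Young weights are chosen such that twice the right-hand side of
    \<open>X\<close> contains \<open>?a\<close> and \<open>4 / \<Delta>t\<^sup>2 * ?m\<close> once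
    each. Their sum is at most \<open>?X\<close>, which is absorbed on the left.\<close>
  have QQ: "1 / (2 * cu) * ip Q Q \<le> ?a / 2"
    using form_a_upper[OF QY(1)] cu_pos by (simp add: field_simps)
  have "2 * \<bar>ip Q (dx w)\<bar> \<le> 1 / (2 * cu) * ip Q Q + ip (dx w) (dx w) / (1 / (2 * cu))"
    by (rule L2_inner_young_abs[OF ec_V[OF QY(1)] ec_dx[OF w]]) (use cu_pos in simp)
  moreover have "ip (dx w) (dx w) / (1 / (2 * cu)) \<le> 4 * (cu * ?L)"
    using mult_left_mono[OF dd, of "2 * cu"] cu_pos by simp
  ultimately have 1: "2 * \<bar>ip Q (dx w)\<bar> \<le> ?a / 2 + 4 * (cu * ?L)" using QQ by linarith
  have "2 * \<bar>ip (i_cross Q) w\<bar> \<le> 1 / (2 * cu) * ip (i_cross Q) (i_cross Q) + ip w w / (1 / (2 * cu))"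
    by (rule L2_inner_young_abs[OF ec_i_cross[OF QY(1)] ec_V[OF w]]) (use cu_pos in simp)
  moreover have "ip w w / (1 / (2 * cu)) \<le> 8 * (cu * ?M)"
    using mult_left_mono[OF ww, of "2 * cu"] cu_pos by simp
  moreover have "1 / (2 * cu) * ip (i_cross Q) (i_cross Q) \<le> 1 / (2 * cu) * ip Q Q"
    using ip_i_cross_self_le[OF QY(1)] cu_pos by (intro mult_left_mono) auto
  ultimately have 2: "2 * \<bar>ip (i_cross Q) w\<bar> \<le> ?a / 2 + 8 * (cu * ?M)" using QQ by linarith
  have "2 * \<bar>ip ?KY w\<bar> \<le> 1 / cu * ip ?KY ?KY + ip w w / (1 / cu)"
    by (rule L2_inner_young_abs[OF ec_Ky[OF QY(2)] ec_V[OF w]]) (use cu_pos in simp)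
  moreover have "ip w w / (1 / cu) \<le> 4 * (cu * ?M)"
    using mult_left_mono[OF ww, of cu] cu_pos by simp
  moreover have "1 / cu * ip ?KY ?KY \<le> ?m"
    using mass_y_upper[OF QY(2)] cu_pos by (simp add: field_simps)
  ultimately have "2 * ip ?KY w \<le> ?m + 4 * (cu * ?M)" by linarith
  then have "4 / \<Delta>t\<^sup>2 * (2 * ip ?KY w) \<le> 4 / \<Delta>t\<^sup>2 * (?m + 4 * (cu * ?M))"
    by (intro mult_left_mono) auto
  then have 3: "2 * (4 / \<Delta>t\<^sup>2 * ip ?KY w) \<le> 4 / \<Delta>t\<^sup>2 * ?m + 16 * (cu * (?M / \<Delta>t\<^sup>2))"
    by (simp add: algebra_simps)
  have "?a + 4 / \<Delta>t\<^sup>2 * ?m \<le> ?X"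
    using penalty_nonneg[of "\<lambda>e n. trace_at Y e n - lam n"] unfolding condensed_energy_def by linarith
  then have "?X \<le> 4 * (cu * ?L) + 8 * (cu * ?M) + 16 * (cu * (?M / \<Delta>t\<^sup>2))"
    using X 1 2 3 by linarith
  \<comment> \<open>The cross product term gives \<open>?M\<close> without the factor
    \<open>1 / \<Delta>t\<^sup>2\<close>; this is where the bound depends on the final time.\<close>
  also have "8 * (cu * ?M) \<le> 8 * (cu * (T\<^sup>2 * (?M / \<Delta>t\<^sup>2)))"
  proof -
    have "0 \<le> ?M" unfolding M_graph_def using len_pos by (intro sum_nonneg) (simp add: less_imp_le)
    moreover have "\<Delta>t\<^sup>2 \<le> T\<^sup>2" using assms(2) \<Delta>t_pos by (intro power_mono) auto
    ultimately have "\<Delta>t\<^sup>2 * (?M / \<Delta>t\<^sup>2) \<le> T\<^sup>2 * (?M / \<Delta>t\<^sup>2)" by (intro mult_right_mono) auto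
    then have "?M \<le> T\<^sup>2 * (?M / \<Delta>t\<^sup>2)" using \<Delta>t_pos by simp
    then show ?thesis using cu_pos by (intro mult_left_mono) auto
  qed
  also have "4 * (cu * ?L) \<le> cu * (16 + 8 * T\<^sup>2) * ?L"
  proof -
    have "0 \<le> ?L" unfolding L_graph_def using len_pos by (intro sum_nonneg) (simp add: less_imp_le)
    then have "cu * ?L * 4 \<le> cu * ?L * (16 + 8 * T\<^sup>2)"
      using cu_pos by (intro mult_left_mono) (auto intro: order_trans[OF _ add_increasing2])
    then show ?thesis by (simp add: mult_ac)
  qed
  finally show ?thesis by (simp add: algebra_simps)
qed

end

subsection \<open>Elliptic coefficients\<close>

lemma edge_point_in_open_segment:
  assumes "0 < s" "s < len e" shows "edge_point e s \<in> open_segment (fst e) (snd e)"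
proof -
  have "edge_point e s = (1 - s / len e) *\<^sub>R fst e + (s / len e) *\<^sub>R snd e"
    by (simp add: edge_point_def tangent_def algebra_simps divide_inverse)
  moreover have "fst e \<noteq> snd e" using assms by (auto simp: len_def)
  ultimately show ?thesis using assms unfolding in_segment by (intro conjI exI[of _ "s / len e"]) auto
qed

text \<open>Ellipticity is only assumed almost everywhere; for a constant coefficient one good
  interior point is enough, and an interval of positive measure contains one.\<close>

lemma AE_lborel_interval_ex:
  assumes "AE s in lborel. s \<in> {0..l} \<longrightarrow> P s" "0 < (l::real)"
  shows "\<exists>s\<in>{0<..<l}. P s"
proof (rule ccontr)
  assume "\<not> ?thesis"
  then have "AE s in lborel. s \<notin> {0<..<l}" using assms(1) by (auto elim!: eventually_mono)
  then have "emeasure lborel {0<..<l} = 0" by (subst (asm) AE_iff_measurable[of "{0<..<l}"]) auto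
  then show False using assms(2) by simp
qed

text \<open>The midpoint serves as a representative, since coefficients are constant only on the
  open segment. Its bounds are transferred from some point where they are known to hold.\<close>

lemma elliptic_edgewise_constant:
  assumes "elliptic_coeff G c1 c2 K" "edgewise_constant G K" "e \<in> edges G" "0 < len e"
  defines "A \<equiv> K (edge_point e (len e / 2))"
  shows "0 < s \<Longrightarrow> s < len e \<Longrightarrow> K (edge_point e s) = A" "transpose A = A"
    "c1 * (norm \<xi>)\<^sup>2 \<le> \<xi> \<bullet> (A *v \<xi>)" "\<xi> \<bullet> (A *v \<xi>) \<le> c2 * (norm \<xi>)\<^sup>2"
proof -
  have mid: "edge_point e (len e / 2) \<in> open_segment (fst e) (snd e)"
    using assms(4) by (intro edge_point_in_open_segment) auto
  have const: "K (edge_point e s) = A" if "0 < s" "s < len e" for s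
    using assms(2,3) edge_point_in_open_segment[OF that] mid unfolding edgewise_constant_def A_def by metis
  then show "0 < s \<Longrightarrow> s < len e \<Longrightarrow> K (edge_point e s) = A" .
  have "edge_point e (len e / 2) \<in> skeleton G"
    using mid assms(3) segment_open_subset_closed unfolding skeleton_def by blast
  then show "transpose A = A" using assms(1) unfolding elliptic_coeff_def A_def by blast
  have "AE s in lborel. s \<in> {0..len e} \<longrightarrow>
        (\<forall>\<xi>. c1 * (norm \<xi>)\<^sup>2 \<le> \<xi> \<bullet> (K (edge_point e s) *v \<xi>) \<and>
             \<xi> \<bullet> (K (edge_point e s) *v \<xi>) \<le> c2 * (norm \<xi>)\<^sup>2)"
    using assms(1,3) unfolding elliptic_coeff_def by blast
  from AE_lborel_interval_ex[OF this assms(4)] obtain s where "0 < s" "s < len e"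
    "\<forall>\<xi>. c1 * (norm \<xi>)\<^sup>2 \<le> \<xi> \<bullet> (K (edge_point e s) *v \<xi>) \<and>
             \<xi> \<bullet> (K (edge_point e s) *v \<xi>) \<le> c2 * (norm \<xi>)\<^sup>2"
    by auto
  then show "c1 * (norm \<xi>)\<^sup>2 \<le> \<xi> \<bullet> (A *v \<xi>)" "\<xi> \<bullet> (A *v \<xi>) \<le> c2 * (norm \<xi>)\<^sup>2"
    using const by auto
qed

text \<open>Evaluate the nonnegative form at \<open>c x - A x\<close>. By symmetry
  \<open>(x, A A x) = |A x|^2\<close>, and the term \<open>(A x, A A x)\<close> is at most
  \<open>c |A x|^2\<close>, so one common factor \<open>c\<close> can be divided out.\<close>

lemma symmetric_psd_norm_mult_le:
  fixes A :: "real^'n^'n"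
  assumes "transpose A = A" "0 < c" "\<And>\<xi>. 0 \<le> \<xi> \<bullet> (A *v \<xi>)" "\<And>\<xi>. \<xi> \<bullet> (A *v \<xi>) \<le> c * (norm \<xi>)\<^sup>2"
  shows "(A *v x) \<bullet> (A *v x) \<le> c * (x \<bullet> (A *v x))"
proof -
  let ?y = "A *v x"
  have sym: "x \<bullet> (A *v ?y) = ?y \<bullet> ?y"
    using assms(1) by (metis dot_lmul_matrix transpose_matrix_vector)
  have "0 \<le> (c *\<^sub>R x - ?y) \<bullet> (A *v (c *\<^sub>R x - ?y))" by (rule assms(3))
  also have "\<dots> = c * c * (x \<bullet> ?y) - 2 * c * (?y \<bullet> ?y) + ?y \<bullet> (A *v ?y)"
    by (simp add: matrix_vector_mult_diff_distrib matrix_vector_mult_scaleR inner_diff_left inner_diff_right sym algebra_simps)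
  also have "?y \<bullet> (A *v ?y) \<le> c * (?y \<bullet> ?y)"
    using assms(4)[of ?y] by (simp add: power2_norm_eq_inner)
  finally have "0 \<le> c * (c * (x \<bullet> ?y) - ?y \<bullet> ?y)" by (simp add: algebra_simps)
  then show ?thesis using assms(2) by (simp add: zero_le_mult_iff)
qed

lemma linear_block_diag: "linear (block_diag A B)"
  by (rule linearI) (simp_all add: block_diag_def matrix_vector_right_distrib matrix_vector_mult_scaleR)

lemma block_diag_bounds:
  assumes A: "transpose A = A" "\<And>\<xi>. a1 * (norm \<xi>)\<^sup>2 \<le> \<xi> \<bullet> (A *v \<xi>)" "\<And>\<xi>. \<xi> \<bullet> (A *v \<xi>) \<le> a2 * (norm \<xi>)\<^sup>2"
    and B: "transpose B = B" "\<And>\<xi>. b1 * (norm \<xi>)\<^sup>2 \<le> \<xi> \<bullet> (B *v \<xi>)" "\<And>\<xi>. \<xi> \<bullet> (B *v \<xi>) \<le> b2 * (norm \<xi>)\<^sup>2"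
    and c: "0 < cl" "cl \<le> a1" "cl \<le> b1" "a2 \<le> cu" "b2 \<le> cu" "0 < cu"
  shows "cl * (x \<bullet> x) \<le> x \<bullet> block_diag A B x"
    "block_diag A B x \<bullet> block_diag A B x \<le> cu * (x \<bullet> block_diag A B x)"
proof -
  have lower: "cl * (\<xi> \<bullet> \<xi>) \<le> \<xi> \<bullet> (M *v \<xi>)"
    if "\<And>\<xi>. m * (norm \<xi>)\<^sup>2 \<le> \<xi> \<bullet> (M *v \<xi>)" "cl \<le> m" for m and M :: "real^3^3" and \<xi>
    using that(1)[of \<xi>] mult_right_mono[OF that(2), of "\<xi> \<bullet> \<xi>"] by (simp add: power2_norm_eq_inner)
  have upper: "(M *v \<xi>) \<bullet> (M *v \<xi>) \<le> cu * (\<xi> \<bullet> (M *v \<xi>))"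
    if M: "transpose M = M" "\<And>\<xi>. cl * (\<xi> \<bullet> \<xi>) \<le> \<xi> \<bullet> (M *v \<xi>)" "\<And>\<xi>. \<xi> \<bullet> (M *v \<xi>) \<le> m * (norm \<xi>)\<^sup>2" "m \<le> cu"
    for m and M :: "real^3^3" and \<xi>
  proof (rule symmetric_psd_norm_mult_le[OF M(1) c(6)])
    fix \<xi> :: "real^3"
    have "0 \<le> cl * (\<xi> \<bullet> \<xi>)" using c(1) by simp
    then show "0 \<le> \<xi> \<bullet> (M *v \<xi>)" using M(2)[of \<xi>] by linarith
    show "\<xi> \<bullet> (M *v \<xi>) \<le> cu * (norm \<xi>)\<^sup>2"
      using M(3)[of \<xi>] mult_right_mono[OF M(4), of "(norm \<xi>)\<^sup>2"] by simp
  qed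
  note lA = lower[OF A(2) c(2)] and lB = lower[OF B(2) c(3)]
  show "cl * (x \<bullet> x) \<le> x \<bullet> block_diag A B x"
    using lA[of "fst x"] lB[of "snd x"] by (simp add: block_diag_def inner_prod_def distrib_left)
  show "block_diag A B x \<bullet> block_diag A B x \<le> cu * (x \<bullet> block_diag A B x)"
    using upper[OF A(1) lA A(3) c(4), of "fst x"] upper[OF B(1) lB B(3) c(5), of "snd x"]
    by (simp add: block_diag_def inner_prod_def distrib_left)
qed

lemma elliptic_network_constant_coefficient:
  assumes net: "network_in \<Omega> G"
    and cn: "elliptic_coeff G cn_min cn_max (C_n C)" "edgewise_constant G (C_n C)"
    and cm: "elliptic_coeff G cm_min cm_max (C_m C)" "edgewise_constant G (C_m C)"
    and cu: "elliptic_coeff G cu_min cu_max (C_u C)" "edgewise_constant G (C_u C)"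
    and cr: "elliptic_coeff G cr_min cr_max (C_r C)" "edgewise_constant G (C_r C)"
    and cl: "0 < cl" "cl \<le> cn_min" "cl \<le> cm_min" "cl \<le> cu_min" "cl \<le> cr_min"
    and cup: "0 < c" "cn_max \<le> c" "cm_max \<le> c" "cu_max \<le> c" "cr_max \<le> c"
    and disc: "1 \<le> p" "\<forall>e\<in>edges G. 0 < \<tau> e" "0 < \<Delta>t"
  shows "constant_coefficient_network G C (\<lambda>e. Cq C (edge_point e (len e / 2)))
    (\<lambda>e. Cy C (edge_point e (len e / 2))) cl c p \<tau> \<Delta>t"
proof (rule constant_coefficient_network.intro)
  have ends: "fst e \<in> nodes G \<and> snd e \<in> nodes G \<and> fst e \<noteq> snd e" if "e \<in> edges G" for e
    using net that unfolding network_in_def by blast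
  then have "edges G \<subseteq> nodes G \<times> nodes G" by (auto simp: mem_Times_iff)
  moreover have "finite (nodes G)" using net unfolding network_in_def by blast
  ultimately show "finite (edges G)" by (meson finite_SigmaI finite_subset)
  have len: "0 < len e" if "e \<in> edges G" for e using ends[OF that] by (simp add: len_def)
  note n = elliptic_edgewise_constant[OF cn _ len] and m = elliptic_edgewise_constant[OF cm _ len]
    and u = elliptic_edgewise_constant[OF cu _ len] and r = elliptic_edgewise_constant[OF cr _ len]
  fix e x
  show "linear (Cq C (edge_point e (len e / 2)))" "linear (Cy C (edge_point e (len e / 2)))"
    unfolding Cq_def[abs_def] Cy_def[abs_def] by (rule linear_block_diag)+
  assume e: "e \<in> edges G"
  show "fst e \<in> nodes G \<and> snd e \<in> nodes G \<and> fst e \<noteq> snd e" by (rule ends[OF e])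
  show "0 < \<tau> e" using disc e by blast
  show "Cq C (edge_point e s) = Cq C (edge_point e (len e / 2))"
    "Cy C (edge_point e s) = Cy C (edge_point e (len e / 2))" if "s \<in> {0<..<len e}" for s
  proof -
    have s: "0 < s" "s < len e" using that by auto
    show "Cq C (edge_point e s) = Cq C (edge_point e (len e / 2))"
      unfolding Cq_def[abs_def] n(1)[OF e e s] m(1)[OF e e s] ..
    show "Cy C (edge_point e s) = Cy C (edge_point e (len e / 2))"
      unfolding Cy_def[abs_def] u(1)[OF e e s] r(1)[OF e e s] ..
  qed
  show "cl * (x \<bullet> x) \<le> x \<bullet> Cq C (edge_point e (len e / 2)) x"
    "Cq C (edge_point e (len e / 2)) x \<bullet> Cq C (edge_point e (len e / 2)) x
      \<le> c * (x \<bullet> Cq C (edge_point e (len e / 2)) x)"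
    unfolding Cq_def using cl cup
    by (intro block_diag_bounds[OF n(2-4)[OF e e] m(2-4)[OF e e]]; simp)+
  show "cl * (x \<bullet> x) \<le> x \<bullet> Cy C (edge_point e (len e / 2)) x"
    "Cy C (edge_point e (len e / 2)) x \<bullet> Cy C (edge_point e (len e / 2)) x
      \<le> c * (x \<bullet> Cy C (edge_point e (len e / 2)) x)"
    unfolding Cy_def using cl cup
    by (intro block_diag_bounds[OF u(2-4)[OF e e] r(2-4)[OF e e]]; simp)+
qed (use cl cup disc in auto)

section \<open>Uniform constants for all networks\<close>

theorem theorem6p1:
  fixes cn_min cn_max cm_min cm_max cu_min cu_max cr_min cr_max D T C\<^sub>s :: real
  assumes "0 < cn_min" "cn_min \<le> cn_max"
    and "0 < cm_min" "cm_min \<le> cm_max"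
    and "0 < cu_min" "cu_min \<le> cu_max"
    and "0 < cr_min" "cr_min \<le> cr_max"
    and "0 < T" "0 < C\<^sub>s"
  shows "\<exists>\<alpha> \<beta>. 0 < \<alpha> \<and> \<alpha> \<le> \<beta> \<and>
    (\<forall>(\<Omega> :: point set) (G :: network) (C :: material) (p :: nat) (\<tau> :: edge \<Rightarrow> real) (\<Delta>t :: real).
       network_in \<Omega> G \<and> diameter \<Omega> = D \<and>
       elliptic_coeff G cn_min cn_max (C_n C) \<and> edgewise_constant G (C_n C) \<and>
       elliptic_coeff G cm_min cm_max (C_m C) \<and> edgewise_constant G (C_m C) \<and>
       elliptic_coeff G cu_min cu_max (C_u C) \<and> edgewise_constant G (C_u C) \<and>
       elliptic_coeff G cr_min cr_max (C_r C) \<and> edgewise_constant G (C_r C) \<and>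
       p \<ge> 1 \<and> (\<forall>e\<in>edges G. \<tau> e > 0) \<and>
       0 < \<Delta>t \<and> \<Delta>t \<le> T \<and> (\<exists>K::nat. real K * \<Delta>t = T) \<and>
       mesh_size G \<le> C\<^sub>s * \<Delta>t
       \<longrightarrow>
       (\<forall>lam\<in>nodal_space G.
          \<alpha> * (M_graph G lam lam / \<Delta>t\<^sup>2 + L_graph G lam lam) \<le> A_hat G C p \<tau> \<Delta>t lam lam \<and>
          A_hat G C p \<tau> \<Delta>t lam lam \<le> \<beta> * (M_graph G lam lam / \<Delta>t\<^sup>2 + L_graph G lam lam)))"
proof -
  define cl where "cl = min (min cn_min cm_min) (min cu_min cr_min)"
  define cu where "cu = max (max cn_max cm_max) (max cu_max cr_max)"
  have cl: "0 < cl" "cl \<le> cn_min" "cl \<le> cm_min" "cl \<le> cu_min" "cl \<le> cr_min"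
    using assms by (auto simp: cl_def)
  have cu: "0 < cu" "cn_max \<le> cu" "cm_max \<le> cu" "cu_max \<le> cu" "cr_max \<le> cu"
    using assms by (auto simp: cu_def)
  define \<alpha> where "\<alpha> = cl / (5 + 4 * C\<^sub>s\<^sup>2 + 4 * C\<^sub>s\<^sup>2 * T\<^sup>2 + T\<^sup>2)"
  \<comment> \<open>The maximum secures \<alpha> \<le> \<beta> directly; enlarging the factor is
    harmless because the graph norm is nonnegative.\<close>
  define \<beta> where "\<beta> = max \<alpha> (cu * (16 + 8 * T\<^sup>2))"
  have "0 < 5 + 4 * C\<^sub>s\<^sup>2 + 4 * C\<^sub>s\<^sup>2 * T\<^sup>2 + T\<^sup>2"
    by (intro add_pos_nonneg) auto
  then have \<alpha>: "0 < \<alpha>" "\<alpha> \<le> \<beta>" using cl by (simp_all add: \<alpha>_def \<beta>_def)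
  have main: "\<alpha> * (M_graph G lam lam / \<Delta>t\<^sup>2 + L_graph G lam lam) \<le> A_hat G C p \<tau> \<Delta>t lam lam \<and>
      A_hat G C p \<tau> \<Delta>t lam lam \<le> \<beta> * (M_graph G lam lam / \<Delta>t\<^sup>2 + L_graph G lam lam)"
    if net: "network_in \<Omega> G"
      and c: "elliptic_coeff G cn_min cn_max (C_n C)" "edgewise_constant G (C_n C)"
        "elliptic_coeff G cm_min cm_max (C_m C)" "edgewise_constant G (C_m C)"
        "elliptic_coeff G cu_min cu_max (C_u C)" "edgewise_constant G (C_u C)"
        "elliptic_coeff G cr_min cr_max (C_r C)" "edgewise_constant G (C_r C)"
      and disc: "1 \<le> p" "\<forall>e\<in>edges G. 0 < \<tau> e" "0 < \<Delta>t" "\<Delta>t \<le> T" "mesh_size G \<le> C\<^sub>s * \<Delta>t"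
    for \<Omega> G C p \<tau> \<Delta>t lam
  proof -
    interpret constant_coefficient_network G C "\<lambda>e. Cq C (edge_point e (len e / 2))"
      "\<lambda>e. Cy C (edge_point e (len e / 2))" cl cu p \<tau> \<Delta>t
      by (rule elliptic_network_constant_coefficient[OF net c cl cu disc(1-3)])
    have len_le: "len e \<le> C\<^sub>s * \<Delta>t" if "e \<in> edges G" for e
      using order_trans[OF Max_ge disc(5)[unfolded mesh_size_def]] finite_edges that by simp
    obtain Q Y where QY: "condensed_solution lam Q Y" using condensed_solution_exists by blast
    let ?N = "M_graph G lam lam / \<Delta>t\<^sup>2 + L_graph G lam lam"
    have "0 \<le> ?N"
      unfolding M_graph_def L_graph_def using len_pos
      by (intro add_nonneg_nonneg divide_nonneg_nonneg sum_nonneg) (simp_all add: less_imp_le)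
    then have "cu * (16 + 8 * T\<^sup>2) * ?N \<le> \<beta> * ?N" by (intro mult_right_mono) (simp_all add: \<beta>_def)
    then show ?thesis
      using condensed_energy_lower[OF QY \<open>0 < C\<^sub>s\<close> disc(4) len_le] condensed_energy_upper[OF QY disc(4)]
      unfolding A_hat_eq_condensed_energy[OF QY] \<alpha>_def by linarith
  qed
  show ?thesis
    by (rule exI[of _ \<alpha>], rule exI[of _ \<beta>], intro conjI[OF \<alpha>(1)] conjI[OF \<alpha>(2)] allI impI ballI,
        elim conjE, rule main)
qed

end
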